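(* Let $\Omega\subseteq\mathbb{R}^d$ be open with $\mu(\Omega)<\infty$, let $1<q\le\infty$, let $p(\cdot)\in\mathcal{P}$ with $p_+<\infty$, and suppose that there exists $x_0\in\Omega$ such that $p(x_0)=p_-$ and $p(\cdot)\in LH_0\{x_0\}$. Let $\varepsilon>0$ be sufficiently small, let $\varkappa$ be a positive monotonically decreasing function on $(0,\varepsilon]$, and let $0<v\le\infty$. Then $$\left(\int_0^\varepsilon\left[\varkappa(t)\,t^{1/p_-}f^*(t)\right]^v\frac{dt}{t}\right)^{1/v}\le c\,\|f\|_{L_{p(\cdot),q}}$$ holds for some $c>0$ and all $f\in L_{p(\cdot),q}(\Omega)$ if, and only if, $\varkappa$ is bounded on $(0,\varepsilon]$ and $q\le v\le\infty$, where for $v=\infty$ the inequality is to be read as $$\sup_{0<t<\varepsilon}\varkappa(t)\,t^{1/p_-}f^*(t)\le c\,\|f\|_{L_{p(\cdot),q}}.\qquad( * )$$ In particular, if $\varkappa$ is an arbitrary non-negative function on $(0,\varepsilon]$, then $( * )$ holds (for some $c>0$ and all $f\in L_{p(\cdot),q}(\Omega)$) if, and only if, $\varkappa$ is bounded.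
   Context: $\mu$ is Lebesgue measure on $\Omega$; $\chi_A$ is the characteristic function of $A$. "Sufficiently small" means $0<\varepsilon\le\varepsilon_0$ for some $\varepsilon_0>0$ depending only on $\Omega$, $p(\cdot)$ and $q$. For a measurable $p(\cdot):\Omega\to(0,\infty)$ put $p_-=\operatorname{ess\,inf}_{x\in\Omega}p(x)$, $p_+=\operatorname{ess\,sup}_{x\in\Omega}p(x)$. $\mathcal{P}$ is the set of such functions with $p_->0$ (exponent functions). Log-Hölder continuity: $r(\cdot)\in LH_0\{x_0\}$ (locally log-Hölder continuous at $x_0\in\Omega$) if there is $C_0>0$ with $|r(x)-r(x_0)|\le\frac{C_0}{-\log(|x-x_0|)}$ for all $x\in\Omega$ with $|x-x_0|<1/2$. Variable Lebesgue quasi-norm: $\|f\|_{p(\cdot)}=\inf\{\lambda>0:\int_\Omega(|f(x)|/\lambda)^{p(x)}\,dx\le1\}$. Variable Lorentz space $L_{p(\cdot),q}(\Omega)$: the measurable $f:\Omega\to\mathbb{R}$ with finite quasi-norm $$\|f\|_{L_{p(\cdot),q}}=\left(\int_0^\infty u^q\,\|\chi_{\{|f|>u\}}\|_{p(\cdot)}^q\,\frac{du}{u}\right)^{1/q}\ (0<q<\infty),\qquad \|f\|_{L_{p(\cdot),\infty}}=\sup_{u>0}u\,\|\chi_{\{|f|>u\}}\|_{p(\cdot)}.$$ Rearrangement: $f^*(t)=\inf\{s>0:\mu(\{|f|>s\})\le t\}$, $t\ge0$ (with $\inf\emptyset=\infty$). *)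

theory Defs
  imports "HOL-Probability.Essential_Supremum"
begin

text \<open>
  A function on \<open>\<Omega>\<close> is modelled by a total function of which only the values on \<open>\<Omega>\<close> matter;
  measurability on \<open>\<Omega>\<close> is measurability with respect to \<^term>\<open>lebesgue_on \<Omega>\<close>. Quantities that may be
  infinite take values in \<^typ>\<open>ennreal\<close>, where \<open>Inf {} = \<infinity>\<close>.
\<close>

definition exponent_minus :: "'a::euclidean_space set \<Rightarrow> ('a \<Rightarrow> real) \<Rightarrow> ereal" where
  "exponent_minus \<Omega> p = - esssup (lebesgue_on \<Omega>) (\<lambda>x. - ereal (p x))"

definition exponent_plus :: "'a::euclidean_space set \<Rightarrow> ('a \<Rightarrow> real) \<Rightarrow> ereal" where
  "exponent_plus \<Omega> p = esssup (lebesgue_on \<Omega>) (\<lambda>x. ereal (p x))"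

definition exponent_functions :: "'a::euclidean_space set \<Rightarrow> ('a \<Rightarrow> real) set" where
  "exponent_functions \<Omega> =
     {p. p \<in> borel_measurable (lebesgue_on \<Omega>) \<and> (\<forall>x\<in>\<Omega>. 0 < p x) \<and> 0 < exponent_minus \<Omega> p}"

text \<open>At \<open>x = x0\<close> both sides of the inequality below are \<open>0\<close>, since \<^prop>\<open>ln (0::real) = 0\<close>
  and division by \<open>0\<close> gives \<open>0\<close>, so this point imposes no condition.\<close>

definition log_Hoelder_at :: "'a::euclidean_space set \<Rightarrow> 'a \<Rightarrow> ('a \<Rightarrow> real) \<Rightarrow> bool" where
  "log_Hoelder_at \<Omega> x0 r \<longleftrightarrow>
     (\<exists>C0>0. \<forall>x\<in>\<Omega>. norm (x - x0) < 1 / 2 \<longrightarrow> \<bar>r x - r x0\<bar> \<le> C0 / (- ln (norm (x - x0))))"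

text \<open>Powers of extended nonnegative reals; used only for real exponents \<open>a > 0\<close>, where
  \<open>0\<close> is sent to \<open>0\<close> and \<open>\<infinity>\<close> to \<open>\<infinity>\<close>.\<close>

definition ennreal_powr :: "ennreal \<Rightarrow> real \<Rightarrow> ennreal" where
  "ennreal_powr x a = (if x = \<infinity> then \<infinity> else ennreal (enn2real x powr a))"

definition variable_Lebesgue_norm ::
    "'a::euclidean_space set \<Rightarrow> ('a \<Rightarrow> real) \<Rightarrow> ('a \<Rightarrow> real) \<Rightarrow> ennreal" where
  "variable_Lebesgue_norm \<Omega> p f =
     (INF l\<in>{l::real. 0 < l \<and> (\<integral>\<^sup>+x. ennreal ((\<bar>f x\<bar> / l) powr p x) \<partial>lebesgue_on \<Omega>) \<le> 1}. ennreal l)"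

definition variable_Lorentz_norm ::
    "'a::euclidean_space set \<Rightarrow> ('a \<Rightarrow> real) \<Rightarrow> ennreal \<Rightarrow> ('a \<Rightarrow> real) \<Rightarrow> ennreal" where
  "variable_Lorentz_norm \<Omega> p q f =
     (let N = (\<lambda>u::real. variable_Lebesgue_norm \<Omega> p (indicat_real {x\<in>\<Omega>. \<bar>f x\<bar> > u}))
      in if q = \<infinity> then (SUP u\<in>{0<..}. ennreal u * N u)
         else ennreal_powr
           (\<integral>\<^sup>+u\<in>{0<..}. (ennreal (u powr enn2real q) * ennreal_powr (N u) (enn2real q)
                            * ennreal (1 / u)) \<partial>lborel)
           (1 / enn2real q))"

definition variable_Lorentz_space ::
    "'a::euclidean_space set \<Rightarrow> ('a \<Rightarrow> real) \<Rightarrow> ennreal \<Rightarrow> ('a \<Rightarrow> real) set" where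
  "variable_Lorentz_space \<Omega> p q =
     {f. f \<in> borel_measurable (lebesgue_on \<Omega>) \<and> variable_Lorentz_norm \<Omega> p q f < \<infinity>}"

definition rearrangement :: "'a::euclidean_space set \<Rightarrow> ('a \<Rightarrow> real) \<Rightarrow> real \<Rightarrow> ennreal" where
  "rearrangement \<Omega> f t =
     (INF s\<in>{s::real. 0 < s \<and> emeasure lebesgue {x\<in>\<Omega>. \<bar>f x\<bar> > s} \<le> ennreal t}. ennreal s)"

text \<open>The left-hand side of the inequality, with \<open>\<kappa>\<close> the weight. The integral for \<open>v < \<infinity>\<close>
  extends to \<open>\<epsilon>\<close>, the supremum for \<open>v = \<infinity>\<close> is over the open interval.\<close>

definition weighted_rearrangement_norm ::
    "'a::euclidean_space set \<Rightarrow> ('a \<Rightarrow> real) \<Rightarrow> real \<Rightarrow> (real \<Rightarrow> real) \<Rightarrow> ennreal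
      \<Rightarrow> ('a \<Rightarrow> real) \<Rightarrow> ennreal" where
  "weighted_rearrangement_norm \<Omega> p \<epsilon> \<kappa> v f =
     (let g = (\<lambda>t. ennreal (\<kappa> t * t powr (1 / real_of_ereal (exponent_minus \<Omega> p)))
                     * rearrangement \<Omega> f t)
      in if v = \<infinity> then (SUP t\<in>{0<..<\<epsilon>}. g t)
         else ennreal_powr
           (\<integral>\<^sup>+t\<in>{0<..\<epsilon>}. (ennreal_powr (g t) (enn2real v) * ennreal (1 / t)) \<partial>lborel)
           (1 / enn2real v))"

end

theory Submission
  imports Defs
begin

text \<open>
  Write \<open>P\<close> for \<open>p\<^sub>-\<close>, \<open>n\<close> for the dimension and \<open>w\<close> for the volume of the unit ball. Since
  \<open>P \<le> p\<close> almost everywhere, a set of measure at least \<open>t \<le> 1\<close> has an indicator of norm at least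
  \<open>t powr (1 / P)\<close>; integrating over the levels \<open>u < f*(t)\<close> bounds the left-hand side by the Lorentz
  norm, for \<open>v = \<infinity>\<close> directly, for \<open>v = q\<close> by Tonelli's theorem, and in between by interpolation.

  Conversely, by log-Hoelder continuity the indicator of a ball of radius \<open>r\<close> about \<open>x0\<close> has norm
  at most a constant times \<open>r powr (n / P)\<close>. Hence the truncated power
  \<open>max \<bar>x - x0\<bar> \<rho> powr (- n / P)\<close> on that ball has Lorentz norm at most a constant times
  \<open>(ln 2 + n * ln (r / \<rho>)) powr (1 / q)\<close>, while \<open>t powr (1 / P) * f*(t)\<close> is bounded below for
  \<open>t\<close> between \<open>(w / 4) * \<rho> powr n\<close> and \<open>(w / 2) * r powr n\<close>, an interval of logarithmic length
  \<open>ln 2 + n * ln (r / \<rho>)\<close>. Taking \<open>\<rho> = r\<close> bounds \<open>\<kappa>\<close>, and letting \<open>\<rho>\<close> tend to \<open>0\<close>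
  forces \<open>1 / v \<le> 1 / q\<close>.
\<close>

subsection \<open>Powers and integrals\<close>

lemma ennreal_powr_ennreal: "0 \<le> x \<Longrightarrow> ennreal_powr (ennreal x) a = ennreal (x powr a)"
  by (simp add: ennreal_powr_def)

lemma ennreal_powr_mono:
  assumes "x \<le> y" "0 \<le> a"
  shows "ennreal_powr x a \<le> ennreal_powr y a"
proof (cases "y = \<infinity>")
  case False
  then have "x < \<infinity>" "y < \<infinity>"
    using assms(1) by (auto simp: less_top top_unique)
  then show ?thesis
    using assms by (auto simp: ennreal_powr_def intro!: ennreal_leI powr_mono2 enn2real_mono)
qed (simp add: ennreal_powr_def)

text \<open>With an infinite factor both sides agree because \<open>0 powr a = 0\<close> for every
  real \<open>a\<close>, which matches the convention that 0 times infinity is 0.\<close>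

lemma ennreal_powr_mult: "ennreal_powr (x * y) a = ennreal_powr x a * ennreal_powr y a"
proof (cases x; cases y)
  fix r s assume "0 \<le> r" "x = ennreal r" "0 \<le> s" "y = ennreal s"
  then show ?thesis
    by (simp add: ennreal_powr_ennreal powr_mult flip: ennreal_mult)
next
  fix r assume "0 \<le> r" "x = ennreal r" "y = top"
  then show ?thesis
    by (cases "r = 0") (auto simp: ennreal_powr_def ennreal_mult_top)
next
  fix r assume "0 \<le> r" "y = ennreal r" "x = top"
  then show ?thesis
    by (cases "r = 0") (auto simp: ennreal_powr_def ennreal_top_mult)
qed (simp add: ennreal_powr_def)

lemma ennreal_powr_powr: "ennreal_powr (ennreal_powr x a) b = ennreal_powr x (a * b)"
  by (cases x) (auto simp: ennreal_powr_def powr_powr)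

lemma ennreal_powr_one [simp]: "ennreal_powr x 1 = x"
  by (cases x) (auto simp: ennreal_powr_def)

text \<open>The factor \<open>x\<close> to the power \<open>b - a\<close> is split off and
  controlled by \<open>S\<close>. With \<open>a = Q\<close>, \<open>b = V\<close> and
  \<open>S\<close> the supremum bound, this deduces the range q \<le> v < \<infinity> from the case
  v = q.\<close>

lemma ennreal_powr_interpolate:
  assumes "x \<le> ennreal S" "0 \<le> S" "0 < a" "a \<le> b"
  shows "ennreal_powr x b \<le> ennreal (S powr (b - a)) * ennreal_powr x a"
proof -
  have "x < \<infinity>"
    using assms(1) by (rule order_le_less_trans) simp
  then obtain r where r: "0 \<le> r" "x = ennreal r"
    by (cases x) auto
  then have "r \<le> S"
    using assms by (simp add: ennreal_le_iff)
  have "r powr b = r powr (b - a) * r powr a"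
    by (simp flip: powr_add)
  also have "\<dots> \<le> S powr (b - a) * r powr a"
    using r assms \<open>r \<le> S\<close> by (intro mult_right_mono powr_mono2) auto
  finally show ?thesis
    using r by (simp add: ennreal_powr_ennreal ennreal_leI flip: ennreal_mult)
qed

lemma nn_integral_powr_Icc_0:
  assumes "0 < a" "0 \<le> s"
  shows "(\<integral>\<^sup>+u. ennreal (u powr (a - 1)) * indicator {0..s} u \<partial>lborel) = ennreal (s powr a / a)"
proof -
  have "((\<lambda>u. u powr (a - 1)) has_integral s powr (a - 1 + 1) / (a - 1 + 1)) {0..s}"
    using assms by (intro has_integral_powr_from_0) auto
  then have "((\<lambda>u. u powr (a - 1) * indicator {0..s} u) has_integral s powr a / a) UNIV"
    by (subst (asm) has_integral_restrict_UNIV[symmetric])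
      (simp add: indicator_def of_bool_def if_distrib cong: if_cong)
  then have "(\<integral>\<^sup>+u. ennreal (u powr (a - 1) * indicator {0..s} u) \<partial>lborel) = ennreal (s powr a / a)"
    by (intro nn_integral_has_integral_lborel) auto
  then show ?thesis
    by (simp add: ennreal_mult'' ennreal_indicator)
qed

lemma nn_integral_inverse_Icc:
  assumes "0 < a" "a \<le> b"
  shows "(\<integral>\<^sup>+u. ennreal (1 / u) * indicator {a..b} u \<partial>lborel) = ennreal (ln (b / a))"
proof -
  have "(\<integral>\<^sup>+u. ennreal (1 / u) * indicator {a..b} u \<partial>lborel) = ennreal (ln b - ln a)"
    using assms by (intro nn_integral_FTC_Icc) (auto intro!: derivative_eq_intros)
  then show ?thesis
    using assms by (simp add: ln_div)
qed

subsection \<open>Norms of indicator functions\<close>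

lemma AE_exponent_minus_le:
  assumes "exponent_minus \<Omega> p = ereal P"
  shows "AE x in lebesgue_on \<Omega>. P \<le> p x"
proof -
  have "esssup (lebesgue_on \<Omega>) (\<lambda>x. - ereal (p x)) = - ereal P"
    using assms by (metis exponent_minus_def ereal_uminus_uminus)
  moreover have "AE x in lebesgue_on \<Omega>. - ereal (p x) \<le> esssup (lebesgue_on \<Omega>) (\<lambda>x. - ereal (p x))"
    by (rule esssup_AE)
  ultimately show ?thesis
    by simp
qed

text \<open>An admissible \<open>l < 1\<close> satisfies
  \<open>l powr - P \<le> l powr - p x\<close> almost everywhere, so the modular is at least
  \<open>l powr - P * t\<close> and its bound 1 forces \<open>t \<le> l powr P\<close>. For
  \<open>l \<ge> 1\<close> the claim follows from \<open>t \<le> 1\<close>.\<close>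

lemma variable_Lebesgue_norm_indicator_lower:
  assumes \<Omega>: "\<Omega> \<in> sets lebesgue" and P: "exponent_minus \<Omega> p = ereal P" "0 < P"
    and E: "E \<in> sets lebesgue" "E \<subseteq> \<Omega>" "ennreal t \<le> emeasure lebesgue E" and t: "0 < t" "t \<le> 1"
  shows "ennreal (t powr (1 / P)) \<le> variable_Lebesgue_norm \<Omega> p (indicat_real E)"
  unfolding variable_Lebesgue_norm_def
proof (safe intro!: INF_greatest)
  fix l :: real
  assume l: "0 < l" and le: "(\<integral>\<^sup>+x. ennreal ((\<bar>indicat_real E x\<bar> / l) powr p x) \<partial>lebesgue_on \<Omega>) \<le> 1"
  have "t powr (1 / P) \<le> l"
  proof (cases "l \<ge> 1")
    case True
    then show ?thesis
      using t P powr_le_one_le[of t "1/P"] powr_mono2[of "1/P" t 1] by simp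
  next
    case False
    have Eon: "E \<in> sets (lebesgue_on \<Omega>)"
      using \<Omega> E by (subst sets_restrict_space_iff) auto
    have "ennreal (l powr - P) * ennreal t \<le> ennreal (l powr - P) * emeasure (lebesgue_on \<Omega>) E"
      using \<Omega> E by (subst emeasure_restrict_space) (auto intro: mult_left_mono)
    also have "\<dots> = (\<integral>\<^sup>+x. ennreal (l powr - P) * indicator E x \<partial>lebesgue_on \<Omega>)"
      using Eon by (rule nn_integral_cmult_indicator[symmetric])
    also have "\<dots> \<le> (\<integral>\<^sup>+x. ennreal ((\<bar>indicat_real E x\<bar> / l) powr p x) \<partial>lebesgue_on \<Omega>)"
      using AE_exponent_minus_le[OF P(1)]
    proof (intro nn_integral_mono_AE, eventually_elim)
      case (elim x)
      have "l powr - P \<le> l powr - p x"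
        using False l elim by (intro powr_mono') auto
      then have "l powr - P \<le> (1 / l) powr p x"
        using l by (simp add: powr_divide powr_minus_divide)
      then show ?case
        by (auto simp: indicator_def intro: ennreal_leI)
    qed
    also have "\<dots> \<le> 1" by (rule le)
    finally have "ennreal (l powr - P * t) \<le> ennreal 1"
      using t by (simp add: ennreal_mult)
    then have "l powr - P * t \<le> 1"
      by (simp flip: ennreal_1)
    then have "t \<le> l powr P"
      using l by (simp add: powr_minus_divide field_simps)
    then have "t powr (1 / P) \<le> (l powr P) powr (1 / P)"
      using t P by (intro powr_mono2) auto
    then show ?thesis
      using P l by (simp add: powr_powr)
  qed
  then show "ennreal (t powr (1 / P)) \<le> ennreal l"
    by (rule ennreal_leI)
qed

text \<open>Since \<open>0 powr a = 0\<close>, the modular vanishes for every \<open>l > 0\<close>,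
  so the infimum runs over all positive reals.\<close>

lemma variable_Lebesgue_norm_zero [simp]: "variable_Lebesgue_norm \<Omega> p (indicat_real {}) = 0"
proof -
  have "(INF l\<in>{l::real. 0 < l}. ennreal l) \<le> 0"
  proof (rule ennreal_le_epsilon)
    fix e :: real assume "0 < e"
    then have "(INF l\<in>{l::real. 0 < l}. ennreal l) \<le> ennreal e"
      by (intro INF_lower) auto
    then show "(INF l\<in>{l::real. 0 < l}. ennreal l) \<le> 0 + ennreal e"
      by simp
  qed
  then show ?thesis
    by (simp add: variable_Lebesgue_norm_def)
qed

lemma emeasure_lebesgue_ball:
  "0 \<le> r \<Longrightarrow> emeasure lebesgue (ball c r :: 'a::euclidean_space set)
      = ennreal (unit_ball_vol (real DIM('a)) * r ^ DIM('a))"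
  by (simp add: emeasure_ball)

text \<open>On a ball of radius \<open>r\<close> about \<open>x0\<close>, log-Hoelder continuity keeps \<open>r powr (p x0 - p x)\<close>
  bounded, so \<open>p\<close> may be replaced by \<open>p x0\<close>.\<close>

lemma variable_Lebesgue_norm_ball_upper:
  fixes \<Omega> :: "'a::euclidean_space set"
  assumes \<Omega>: "\<Omega> \<in> sets lebesgue" and P: "exponent_minus \<Omega> p = ereal P" "0 < P"
    and x0: "p x0 = P" "log_Hoelder_at \<Omega> x0 p"
  shows "\<exists>M>0. \<forall>r. 0 < r \<and> r < 1/2 \<and> ball x0 r \<subseteq> \<Omega> \<longrightarrow>
    variable_Lebesgue_norm \<Omega> p (indicat_real (ball x0 r)) \<le> ennreal (M * r powr (DIM('a) / P))"
proof -
  define n where "n = real DIM('a)"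
  define w where "w = unit_ball_vol n"
  have n: "0 < n" and w: "0 < w"
    by (auto simp: n_def w_def)
  obtain C where C: "0 < C"
    "\<And>x. x \<in> \<Omega> \<Longrightarrow> norm (x - x0) < 1/2 \<Longrightarrow> \<bar>p x - p x0\<bar> \<le> C / (- ln (norm (x - x0)))"
    using x0(2) unfolding log_Hoelder_at_def by blast
  \<comment> \<open>\<open>H\<close> bounds \<open>r powr (n - n * p x / P)\<close>: multiply the
    log-Hoelder estimate \<open>- ln r * (p x - P) \<le> C\<close> by \<open>n / P\<close> and
    exponentiate.\<close>
  define H where "H = exp (n * C / P)"
  \<comment> \<open>\<open>M \<ge> 1\<close> allows \<open>M powr - p x\<close> to be replaced by
    \<open>M powr - P\<close>, and \<open>w * H \<le> M powr P\<close> brings the modular of the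
    ball below 1.\<close>
  define M where "M = max 1 ((w * H) powr (1 / P))"
  have M: "1 \<le> M"
    by (simp add: M_def)
  have "w * H = ((w * H) powr (1 / P)) powr P"
    using w P by (simp add: powr_powr H_def)
  also have "\<dots> \<le> M powr P"
    using P by (intro powr_mono2) (auto simp: M_def)
  finally have wH: "w * H \<le> M powr P" .
  show ?thesis
  proof (safe intro!: exI[of _ M])
    show "0 < M" using M by simp
    fix r :: real
    assume r: "0 < r" "r < 1/2" "ball x0 r \<subseteq> \<Omega>"
    define l where "l = M * r powr (n / P)"
    have l: "0 < l"
      using M r by (simp add: l_def)
    have pointwise: "(1 / l) powr p x \<le> M powr - P * H * r powr - n"
      if x: "x \<in> ball x0 r" "P \<le> p x" for x
    proof -
      have d: "norm (x - x0) < r"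
        using x by (simp add: dist_norm norm_minus_commute)
      \<comment> \<open>The continuity bound involves the distance to \<open>x0\<close>, which is
        smaller than \<open>r\<close>; as \<open>- ln\<close> is decreasing, it remains valid with
        \<open>r\<close> in place of the distance. At \<open>x0\<close> itself the left-hand side is
        0.\<close>
      have "- ln r * (p x - P) \<le> C"
      proof (cases "x = x0")
        case False
        then have pos: "0 < norm (x - x0)" by simp
        have "ln (norm (x - x0)) \<le> ln r"
          using pos d r(1) by (subst ln_le_cancel_iff) auto
        moreover have "ln r < 0"
          using r by (intro ln_less_zero) auto
        ultimately have ln: "0 < - ln r" "- ln r \<le> - ln (norm (x - x0))"
          by linarith+
        have "p x - P \<le> C / (- ln (norm (x - x0)))"
          using C(2)[of x] x r d x0(1) by auto
        also have "\<dots> \<le> C / (- ln r)"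
          using ln C(1) by (intro divide_left_mono mult_pos_pos) auto
        finally show ?thesis
          using ln by (simp add: field_simps)
      qed (use x0 C in simp)
      then have "n / P * (- ln r * (p x - P)) \<le> n / P * C"
        using n P by (intro mult_left_mono) auto
      then have "ln r * (- (n / P * p x) + n) \<le> n * C / P"
        using P by (simp add: field_simps)
      then have "r powr (- (n / P * p x) + n) \<le> H"
        using r by (simp add: powr_def H_def mult.commute)
      then have "r powr (- (n / P * p x)) * r powr n \<le> H"
        by (simp only: powr_add)
      then have *: "r powr (- (n / P * p x)) \<le> H * r powr - n"
        using r by (simp add: powr_minus_divide field_simps)
      have "(1 / l) powr p x = l powr - p x"
        using l by (simp add: powr_divide powr_minus_divide)
      also have "\<dots> = M powr - p x * r powr (- (n / P * p x))"
        using M r by (simp add: l_def powr_mult powr_powr)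
      also have "\<dots> \<le> M powr - P * (H * r powr - n)"
        using M x * by (intro mult_mono powr_mono) auto
      finally show ?thesis by simp
    qed
    have "(\<integral>\<^sup>+x. ennreal ((\<bar>indicat_real (ball x0 r) x\<bar> / l) powr p x) \<partial>lebesgue_on \<Omega>)
      \<le> (\<integral>\<^sup>+x. ennreal (M powr - P * H * r powr - n) * indicator (ball x0 r) x \<partial>lebesgue_on \<Omega>)"
      using AE_exponent_minus_le[OF P(1)]
      by (intro nn_integral_mono_AE, eventually_elim)
        (use pointwise in \<open>auto simp: indicator_def intro!: ennreal_leI\<close>)
    also have "\<dots> = ennreal (M powr - P * H * r powr - n) * emeasure (lebesgue_on \<Omega>) (ball x0 r)"
      using \<Omega> r by (intro nn_integral_cmult_indicator) (subst sets_restrict_space_iff, auto)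
    also have "\<dots> = ennreal (M powr - P * H * r powr - n) * ennreal (w * r powr n)"
      using \<Omega> r by (subst emeasure_restrict_space)
        (auto simp: emeasure_lebesgue_ball w_def n_def powr_realpow emeasure_ball)
    also have "\<dots> = ennreal (M powr - P * H * r powr - n * (w * r powr n))"
      using w by (subst ennreal_mult) (auto simp: H_def)
    also have "M powr - P * H * r powr - n * (w * r powr n) = (w * H) / M powr P"
      using r by (simp add: powr_minus_divide)
    also have "ennreal ((w * H) / M powr P) \<le> 1"
      using wH M by (simp add: divide_le_eq)
    finally show "variable_Lebesgue_norm \<Omega> p (indicat_real (ball x0 r)) \<le> ennreal (M * r powr (DIM('a) / P))"
      using l unfolding variable_Lebesgue_norm_def
      by (intro INF_lower2[of l]) (auto simp: l_def n_def)
  qed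
qed

subsection \<open>The embedding\<close>

text \<open>Bounds on \<open>rearrangement\<close>, whose value may be infinite, can thereby be
  proved for each real level below it.\<close>

lemma ennreal_le_of_reals_below:
  assumes "\<And>s. 0 < s \<Longrightarrow> ennreal s < x \<Longrightarrow> ennreal s \<le> y"
  shows "x \<le> y"
proof (rule dense_le)
  fix z assume z: "z < x"
  then obtain s where s: "0 \<le> s" "z = ennreal s"
    by (cases z) auto
  then show "z \<le> y"
    using assms[of s] z by (cases "s = 0") auto
qed

lemma distribution_gt_of_less_rearrangement:
  assumes "0 < u" "ennreal u < rearrangement \<Omega> f t"
  shows "ennreal t < emeasure lebesgue {x\<in>\<Omega>. \<bar>f x\<bar> > u}"
proof (rule ccontr)
  assume "\<not> ?thesis"
  then have "rearrangement \<Omega> f t \<le> ennreal u"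
    unfolding rearrangement_def using assms by (intro INF_lower) auto
  then show False
    using assms by simp
qed

lemma sets_superlevel:
  fixes f :: "'a::euclidean_space \<Rightarrow> real"
  assumes "\<Omega> \<in> sets lebesgue" "f \<in> borel_measurable (lebesgue_on \<Omega>)"
  shows "{x\<in>\<Omega>. \<bar>f x\<bar> > u} \<in> sets lebesgue"
proof -
  have "{x\<in>space (lebesgue_on \<Omega>). \<bar>f x\<bar> > u} \<in> sets (lebesgue_on \<Omega>)"
    using assms(2) by measurable
  then show ?thesis
    using assms(1) by (simp add: sets_restrict_space_iff)
qed

lemma variable_Lebesgue_norm_superlevel_lower:
  fixes f :: "'a::euclidean_space \<Rightarrow> real"
  assumes "\<Omega> \<in> sets lebesgue" "exponent_minus \<Omega> p = ereal P" "0 < P"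
    and "f \<in> borel_measurable (lebesgue_on \<Omega>)" "0 < t" "t \<le> 1"
    and "ennreal t \<le> emeasure lebesgue {x\<in>\<Omega>. \<bar>f x\<bar> > u}"
  shows "ennreal (t powr (1 / P)) \<le> variable_Lebesgue_norm \<Omega> p (indicat_real {x\<in>\<Omega>. \<bar>f x\<bar> > u})"
  by (rule variable_Lebesgue_norm_indicator_lower[OF assms(1-3) sets_superlevel[OF assms(1,4)] _ assms(7,5,6)]) blast

definition superlevel_norm ::
    "'a::euclidean_space set \<Rightarrow> ('a \<Rightarrow> real) \<Rightarrow> ('a \<Rightarrow> real) \<Rightarrow> real \<Rightarrow> ennreal" where
  "superlevel_norm \<Omega> p f u = variable_Lebesgue_norm \<Omega> p (indicat_real {x\<in>\<Omega>. \<bar>f x\<bar> > u})"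

text \<open>The outer root is left off, so that integrals can be estimated first and the power
  \<open>1 / Q\<close> taken last.\<close>

definition Lorentz_integral ::
    "'a::euclidean_space set \<Rightarrow> ('a \<Rightarrow> real) \<Rightarrow> real \<Rightarrow> ('a \<Rightarrow> real) \<Rightarrow> ennreal" where
  "Lorentz_integral \<Omega> p Q f =
    (\<integral>\<^sup>+u\<in>{0<..}. (ennreal (u powr Q) * ennreal_powr (superlevel_norm \<Omega> p f u) Q * ennreal (1 / u)) \<partial>lborel)"

lemma variable_Lorentz_norm_top:
  "variable_Lorentz_norm \<Omega> p \<infinity> f = (SUP u\<in>{0<..}. ennreal u * superlevel_norm \<Omega> p f u)"
  by (simp add: variable_Lorentz_norm_def superlevel_norm_def)

lemma variable_Lorentz_norm_ennreal:
  "0 \<le> Q \<Longrightarrow> variable_Lorentz_norm \<Omega> p (ennreal Q) f = ennreal_powr (Lorentz_integral \<Omega> p Q f) (1 / Q)"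
  by (simp add: variable_Lorentz_norm_def superlevel_norm_def Lorentz_integral_def)

lemma Lorentz_integral_eq_powr:
  "0 < Q \<Longrightarrow> Lorentz_integral \<Omega> p Q f = ennreal_powr (variable_Lorentz_norm \<Omega> p (ennreal Q) f) Q"
  by (simp add: variable_Lorentz_norm_ennreal ennreal_powr_powr)

text \<open>Each level u \<le> s < f*(t) has a superlevel set of measure above \<open>t\<close>,
  hence of norm at least \<open>t powr (1 / P)\<close>. For q = \<infinity> the single level u = s
  suffices. For finite q, integrating \<open>u powr (Q - 1)\<close> over (0, s] gives
  \<open>s powr Q / Q\<close>, whence the constant \<open>Q powr (1 / Q)\<close>.\<close>

lemma powr_mult_rearrangement_le:
  fixes \<Omega> :: "'a::euclidean_space set"
  assumes \<Omega>: "\<Omega> \<in> sets lebesgue" and P: "exponent_minus \<Omega> p = ereal P" "0 < P"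
    and f: "f \<in> borel_measurable (lebesgue_on \<Omega>)" and t: "0 < t" "t \<le> 1" and q: "0 < q"
  shows "ennreal (t powr (1 / P)) * rearrangement \<Omega> f t
    \<le> ennreal (if q = \<infinity> then 1 else enn2real q powr (1 / enn2real q)) * variable_Lorentz_norm \<Omega> p q f"
    (is "ennreal ?a * _ \<le> ?B")
proof -
  have lower: "ennreal ?a \<le> superlevel_norm \<Omega> p f u" if "0 < u" "ennreal u < rearrangement \<Omega> f t" for u
    unfolding superlevel_norm_def using distribution_gt_of_less_rearrangement[OF that]
    by (intro variable_Lebesgue_norm_superlevel_lower assms less_imp_le)
  have a: "0 < ?a" using t by simp
  have *: "ennreal ?a * ennreal s \<le> ?B" if s: "0 < s" "ennreal s < rearrangement \<Omega> f t" for s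
  proof (cases q)
    case top
    have "ennreal s * ennreal ?a \<le> ennreal s * superlevel_norm \<Omega> p f s"
      using lower[OF s] by (rule mult_left_mono) simp
    also have "\<dots> \<le> variable_Lorentz_norm \<Omega> p \<infinity> f"
      unfolding variable_Lorentz_norm_top using s by (intro SUP_upper) auto
    finally show ?thesis
      using top by (simp add: mult.commute)
  next
    case (real Q)
    then have Q: "0 < Q" using q by (simp add: order_less_le)
    have "ennreal (?a powr Q) * ennreal (s powr Q / Q)
      = (\<integral>\<^sup>+u. ennreal (?a powr Q) * (ennreal (u powr (Q - 1)) * indicator {0..s} u) \<partial>lborel)"
      using Q s by (subst nn_integral_cmult) (auto simp: nn_integral_powr_Icc_0)
    also have "\<dots> \<le> Lorentz_integral \<Omega> p Q f"
      unfolding Lorentz_integral_def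
    proof (intro nn_integral_mono)
      fix u :: real
      show "ennreal (?a powr Q) * (ennreal (u powr (Q - 1)) * indicator {0..s} u) \<le>
         ennreal (u powr Q) * ennreal_powr (superlevel_norm \<Omega> p f u) Q * ennreal (1 / u) * indicator {0<..} u"
      proof (cases "0 < u \<and> u \<le> s")
        case True
        then have "ennreal u < rearrangement \<Omega> f t"
          using s(2) by (meson ennreal_leI order_le_less_trans)
        then have "ennreal ?a \<le> superlevel_norm \<Omega> p f u"
          using lower True by blast
        then have "ennreal_powr (ennreal ?a) Q \<le> ennreal_powr (superlevel_norm \<Omega> p f u) Q"
          using Q by (intro ennreal_powr_mono) auto
        then have le: "ennreal (?a powr Q) \<le> ennreal_powr (superlevel_norm \<Omega> p f u) Q"
          by (simp add: ennreal_powr_ennreal)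
        have "ennreal (u powr (Q - 1)) = ennreal (u powr Q) * ennreal (1 / u)"
          using True by (simp add: powr_diff flip: ennreal_mult)
        then show ?thesis
          using True mult_right_mono[OF le, of "ennreal (u powr Q) * ennreal (1 / u)"]
          by (simp add: mult_ac)
      qed (auto simp: indicator_def)
    qed
    finally have "ennreal (?a powr Q) * ennreal (s powr Q / Q) \<le> Lorentz_integral \<Omega> p Q f" .
    then have "ennreal Q * (ennreal (?a powr Q) * ennreal (s powr Q / Q)) \<le> ennreal Q * Lorentz_integral \<Omega> p Q f"
      by (rule mult_left_mono) simp
    also have "ennreal Q * (ennreal (?a powr Q) * ennreal (s powr Q / Q)) = ennreal ((?a * s) powr Q)"
      using Q s by (simp add: powr_mult flip: ennreal_mult)
    finally have "ennreal_powr (ennreal ((?a * s) powr Q)) (1 / Q) \<le> ennreal_powr (ennreal Q * Lorentz_integral \<Omega> p Q f) (1 / Q)"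
      using Q by (intro ennreal_powr_mono) auto
    then have "ennreal (?a * s) \<le> ennreal (Q powr (1 / Q)) * variable_Lorentz_norm \<Omega> p (ennreal Q) f"
      using Q s a by (simp add: ennreal_powr_ennreal ennreal_powr_mult powr_powr variable_Lorentz_norm_ennreal)
    then show ?thesis
      using real Q s by (simp add: ennreal_mult)
  qed
  \<comment> \<open>Dividing by the positive real \<open>?a\<close> isolates f*(t), so that the
    bound for all real levels below it passes to f*(t) itself, even if infinite.\<close>
  have "rearrangement \<Omega> f t \<le> ennreal (1 / ?a) * ?B"
  proof (rule ennreal_le_of_reals_below)
    fix s assume s: "0 < s" "ennreal s < rearrangement \<Omega> f t"
    have "ennreal s = ennreal (1 / ?a) * (ennreal ?a * ennreal s)"
      using a s by (simp flip: ennreal_mult)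
    also have "\<dots> \<le> ennreal (1 / ?a) * ?B"
      using *[OF s] by (rule mult_left_mono) simp
    finally show "ennreal s \<le> ennreal (1 / ?a) * ?B" .
  qed
  then have "ennreal ?a * rearrangement \<Omega> f t \<le> ennreal ?a * (ennreal (1 / ?a) * ?B)"
    by (rule mult_left_mono) simp
  also have "\<dots> = ?B"
    using a by (simp flip: mult.assoc ennreal_mult)
  finally show ?thesis .
qed

text \<open>The distribution function is decreasing. Finiteness of the measure of \<Omega> makes it
  real-valued, so that its negative is a monotone real function.\<close>

lemma borel_measurable_distribution:
  fixes f :: "'a::euclidean_space \<Rightarrow> real"
  assumes \<Omega>: "\<Omega> \<in> sets lebesgue" "emeasure lebesgue \<Omega> < \<infinity>" and f: "f \<in> borel_measurable (lebesgue_on \<Omega>)"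
  shows "(\<lambda>u. emeasure lebesgue {x\<in>\<Omega>. \<bar>f x\<bar> > u}) \<in> borel_measurable borel"
proof -
  have E: "{x\<in>\<Omega>. \<bar>f x\<bar> > u} \<in> fmeasurable lebesgue" for u
    by (rule fmeasurableI2[OF fmeasurableI[OF \<Omega>] _ sets_superlevel[OF \<Omega>(1) f]]) blast
  have "mono (\<lambda>u. - measure lebesgue {x\<in>\<Omega>. \<bar>f x\<bar> > u})"
  proof (rule monoI)
    fix u u' :: real assume "u \<le> u'"
    then have "{x\<in>\<Omega>. \<bar>f x\<bar> > u'} \<subseteq> {x\<in>\<Omega>. \<bar>f x\<bar> > u}"
      by auto
    then show "- measure lebesgue {x\<in>\<Omega>. \<bar>f x\<bar> > u} \<le> - measure lebesgue {x\<in>\<Omega>. \<bar>f x\<bar> > u'}"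
      using E by (simp add: measure_mono_fmeasurable fmeasurableD)
  qed
  then have "(\<lambda>u. ennreal (- (- measure lebesgue {x\<in>\<Omega>. \<bar>f x\<bar> > u}))) \<in> borel_measurable borel"
    by (intro measurable_compose[OF _ measurable_ennreal] borel_measurable_uminus borel_measurable_mono)
  moreover have "emeasure lebesgue {x\<in>\<Omega>. \<bar>f x\<bar> > u} = ennreal (measure lebesgue {x\<in>\<Omega>. \<bar>f x\<bar> > u})" for u
    using E by (rule emeasure_eq_measure2)
  ultimately show ?thesis
    by simp
qed

text \<open>Tonelli's theorem applied to \<open>f*(t) powr Q = Q \<integral> u powr (Q - 1) du\<close>, the integral over
  \<open>u < f*(t)\<close>, that is, over those \<open>u\<close> at which the distribution function exceeds \<open>t\<close>.\<close>

lemma rearrangement_integral_majorant: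
  fixes \<Omega> :: "'a::euclidean_space set"
  assumes \<Omega>: "\<Omega> \<in> sets lebesgue" "emeasure lebesgue \<Omega> < \<infinity>" and P: "exponent_minus \<Omega> p = ereal P" "0 < P"
    and f: "f \<in> borel_measurable (lebesgue_on \<Omega>)" and \<epsilon>: "0 < \<epsilon>" "\<epsilon> \<le> 1" and Q: "0 < Q"
  obtains G where "G \<in> borel_measurable lborel"
    "\<And>t. t \<in> {0<..\<epsilon>} \<Longrightarrow>
      ennreal_powr (ennreal (t powr (1 / P)) * rearrangement \<Omega> f t) Q * ennreal (1 / t) \<le> G t"
    "(\<integral>\<^sup>+t. G t \<partial>lborel) \<le> ennreal P * Lorentz_integral \<Omega> p Q f"
proof -
  define d where "d u = emeasure lebesgue {x\<in>\<Omega>. \<bar>f x\<bar> > u}" for u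
  have d[measurable]: "d \<in> borel_measurable borel"
    unfolding d_def using \<Omega> f by (rule borel_measurable_distribution)
  define h where "h t u = (if 0 < t \<and> t \<le> \<epsilon> \<and> 0 < u \<and> ennreal t < d u
    then ennreal (Q * t powr (Q / P - 1) * u powr (Q - 1)) else 0)" for t u
  have h[measurable]: "case_prod h \<in> borel_measurable (lborel \<Otimes>\<^sub>M lborel)"
    unfolding h_def by measurable
  show thesis
  \<comment> \<open>The majorant is Borel measurable in \<open>t\<close> as a parameter integral, so
    constants can later be taken out of its integral.\<close>
  proof (rule that[of "\<lambda>t. \<integral>\<^sup>+u. h t u \<partial>lborel"])
    show "(\<lambda>t. \<integral>\<^sup>+u. h t u \<partial>lborel) \<in> borel_measurable lborel"
      by measurable
  next
    fix t assume t: "t \<in> {0<..\<epsilon>}"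
    define I where "I = (\<integral>\<^sup>+u. (if 0 < u \<and> ennreal t < d u then ennreal (Q * u powr (Q - 1)) else 0) \<partial>lborel)"
    have "rearrangement \<Omega> f t \<le> ennreal_powr I (1 / Q)"
    proof (rule ennreal_le_of_reals_below)
      fix s assume s: "0 < s" "ennreal s < rearrangement \<Omega> f t"
      have "ennreal (s powr Q) = ennreal Q * ennreal (s powr Q / Q)"
        using Q by (simp flip: ennreal_mult)
      also have "\<dots> = (\<integral>\<^sup>+u. ennreal Q * (ennreal (u powr (Q - 1)) * indicator {0..s} u) \<partial>lborel)"
        using Q s by (subst nn_integral_cmult) (auto simp: nn_integral_powr_Icc_0)
      also have "\<dots> \<le> I"
        unfolding I_def
      proof (rule nn_integral_mono)
        fix u :: real
        show "ennreal Q * (ennreal (u powr (Q - 1)) * indicator {0..s} u)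
          \<le> (if 0 < u \<and> ennreal t < d u then ennreal (Q * u powr (Q - 1)) else 0)"
        proof (cases "0 < u \<and> u \<le> s")
          case True
          then have "ennreal u < rearrangement \<Omega> f t"
            using s(2) by (meson ennreal_leI order_le_less_trans)
          then have "ennreal t < d u"
            unfolding d_def using True by (intro distribution_gt_of_less_rearrangement) auto
          then show ?thesis
            using True Q by (simp add: ennreal_mult)
        qed (auto simp: indicator_def)
      qed
      finally have "ennreal_powr (ennreal (s powr Q)) (1 / Q) \<le> ennreal_powr I (1 / Q)"
        using Q by (intro ennreal_powr_mono) auto
      then show "ennreal s \<le> ennreal_powr I (1 / Q)"
        using s Q by (simp add: ennreal_powr_ennreal powr_powr)
    qed
    then have "ennreal_powr (rearrangement \<Omega> f t) Q \<le> ennreal_powr (ennreal_powr I (1 / Q)) Q"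
      using Q by (intro ennreal_powr_mono) auto
    then have fI: "ennreal_powr (rearrangement \<Omega> f t) Q \<le> I"
      using Q by (simp add: ennreal_powr_powr)
    have "ennreal_powr (ennreal (t powr (1 / P)) * rearrangement \<Omega> f t) Q * ennreal (1 / t)
      = ennreal (t powr (Q / P - 1)) * ennreal_powr (rearrangement \<Omega> f t) Q"
      using t by (simp add: ennreal_powr_mult ennreal_powr_ennreal powr_powr powr_diff mult_ac divide_inverse
          flip: ennreal_mult)
        (simp add: ennreal_mult mult_ac)
    also have "\<dots> \<le> ennreal (t powr (Q / P - 1)) * I"
      using fI by (rule mult_left_mono) simp
    also have "\<dots> = (\<integral>\<^sup>+u. ennreal (t powr (Q / P - 1)) *
        (if 0 < u \<and> ennreal t < d u then ennreal (Q * u powr (Q - 1)) else 0) \<partial>lborel)"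
      unfolding I_def by (rule nn_integral_cmult[symmetric]) measurable
    also have "\<dots> = (\<integral>\<^sup>+u. h t u \<partial>lborel)"
      using t Q by (intro nn_integral_cong) (auto simp: h_def mult_ac simp flip: ennreal_mult)
    finally show "ennreal_powr (ennreal (t powr (1 / P)) * rearrangement \<Omega> f t) Q * ennreal (1 / t)
      \<le> (\<integral>\<^sup>+u. h t u \<partial>lborel)" .
  next
    have inner: "(\<integral>\<^sup>+t. h t u \<partial>lborel) \<le> ennreal P * (ennreal (u powr Q) *
        ennreal_powr (superlevel_norm \<Omega> p f u) Q * ennreal (1 / u) * indicator {0<..} u)" for u
    proof (cases "0 < u \<and> 0 < d u")
      case True
      \<comment> \<open>For fixed \<open>u\<close> the variable \<open>t\<close> ranges up to the
        minimum of \<epsilon> and \<open>d u\<close>, a real \<open>m\<close>. The superlevel set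
        has measure at least \<open>m\<close>, and \<open>m \<le> 1\<close>, so its norm is at least
        \<open>m powr (1 / P)\<close>, which is exactly what the integral in \<open>t\<close>
        produces up to constants.\<close>
      have "min (ennreal \<epsilon>) (d u) \<le> ennreal \<epsilon>" by simp
      then have "min (ennreal \<epsilon>) (d u) < top"
        by (rule order_le_less_trans) simp
      then obtain m where m: "0 \<le> m" "min (ennreal \<epsilon>) (d u) = ennreal m"
        by (cases "min (ennreal \<epsilon>) (d u)") auto
      have "0 < ennreal m"
        using True \<epsilon> m(2) by (metis ennreal_less_zero_iff min_less_iff_conj)
      then have m0: "0 < m" by simp
      have "ennreal m \<le> ennreal \<epsilon>" and md: "ennreal m \<le> d u"
        using m(2) by (metis min.cobounded1, metis min.cobounded2)
      then have m1: "m \<le> 1"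
        using \<epsilon> by (simp add: ennreal_le_iff)
      have "ennreal (m powr (1 / P)) \<le> superlevel_norm \<Omega> p f u"
        unfolding superlevel_norm_def using md[unfolded d_def] m0 m1
        by (intro variable_Lebesgue_norm_superlevel_lower assms)
      then have "ennreal_powr (ennreal (m powr (1 / P))) Q \<le> ennreal_powr (superlevel_norm \<Omega> p f u) Q"
        using Q by (intro ennreal_powr_mono) auto
      then have mN: "ennreal (m powr (Q / P)) \<le> ennreal_powr (superlevel_norm \<Omega> p f u) Q"
        by (simp add: ennreal_powr_ennreal powr_powr)
      have "(\<integral>\<^sup>+t. h t u \<partial>lborel)
        \<le> (\<integral>\<^sup>+t. ennreal (Q * u powr (Q - 1)) * (ennreal (t powr (Q / P - 1)) * indicator {0..m} t) \<partial>lborel)"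
      proof (rule nn_integral_mono)
        fix t :: real
        show "h t u \<le> ennreal (Q * u powr (Q - 1)) * (ennreal (t powr (Q / P - 1)) * indicator {0..m} t)"
        proof (cases "0 < t \<and> t \<le> \<epsilon> \<and> ennreal t < d u")
          case t: True
          then have "ennreal t \<le> min (ennreal \<epsilon>) (d u)"
            by (auto intro: ennreal_leI)
          then have "t \<le> m"
            unfolding m(2) using m(1) by (simp add: ennreal_le_iff)
          then show ?thesis
            using t True Q by (simp add: h_def mult_ac flip: ennreal_mult)
        qed (auto simp: h_def)
      qed
      also have "\<dots> = ennreal (Q * u powr (Q - 1)) * ennreal (m powr (Q / P) / (Q / P))"
        using Q P m0 by (subst nn_integral_cmult) (auto simp: nn_integral_powr_Icc_0)
      also have "\<dots> = ennreal P * (ennreal (u powr Q) * ennreal (m powr (Q / P)) * ennreal (1 / u))"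
        using Q P True by (simp add: powr_diff field_simps flip: ennreal_mult)
      also have "\<dots> \<le> ennreal P * (ennreal (u powr Q) * ennreal_powr (superlevel_norm \<Omega> p f u) Q * ennreal (1 / u))"
        using mN by (intro mult_left_mono mult_right_mono) auto
      finally show ?thesis
        using True by simp
    next
      case False
      then have "h t u = 0" for t
        by (auto simp: h_def not_less)
      then show ?thesis by simp
    qed
    have "(\<integral>\<^sup>+t. \<integral>\<^sup>+u. h t u \<partial>lborel \<partial>lborel) = (\<integral>\<^sup>+u. \<integral>\<^sup>+t. h t u \<partial>lborel \<partial>lborel)"
      by (rule lborel_pair.Fubini'[OF h, symmetric])
    \<comment> \<open>The factor \<open>P\<close> leaves the integral while the integrand is still
      built from the measurable \<open>h\<close>; the integrand of \<open>Lorentz_integral\<close>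
      is then compared only pointwise.\<close>
    also have "\<dots> = (\<integral>\<^sup>+u. ennreal P * (ennreal (1 / P) * \<integral>\<^sup>+t. h t u \<partial>lborel) \<partial>lborel)"
      using P by (simp flip: mult.assoc ennreal_mult)
    also have "\<dots> = ennreal P * (\<integral>\<^sup>+u. ennreal (1 / P) * (\<integral>\<^sup>+t. h t u \<partial>lborel) \<partial>lborel)"
      by (rule nn_integral_cmult) measurable
    also have "\<dots> \<le> ennreal P * Lorentz_integral \<Omega> p Q f"
      unfolding Lorentz_integral_def
    proof (intro mult_left_mono nn_integral_mono)
      fix u
      have "ennreal (1 / P) * (\<integral>\<^sup>+t. h t u \<partial>lborel) \<le> ennreal (1 / P) * (ennreal P * (ennreal (u powr Q) *
        ennreal_powr (superlevel_norm \<Omega> p f u) Q * ennreal (1 / u) * indicator {0<..} u))"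
        using inner by (rule mult_left_mono) simp
      also have "\<dots> = ennreal (u powr Q) *
        ennreal_powr (superlevel_norm \<Omega> p f u) Q * ennreal (1 / u) * indicator {0<..} u"
        using P by (simp flip: mult.assoc ennreal_mult)
      finally show "ennreal (1 / P) * (\<integral>\<^sup>+t. h t u \<partial>lborel) \<le> ennreal (u powr Q) *
        ennreal_powr (superlevel_norm \<Omega> p f u) Q * ennreal (1 / u) * indicator {0<..} u" .
    qed simp
    finally show "(\<integral>\<^sup>+t. \<integral>\<^sup>+u. h t u \<partial>lborel \<partial>lborel) \<le> ennreal P * Lorentz_integral \<Omega> p Q f" .
  qed
qed

text \<open>A bound \<open>K\<close> on the weight reduces everything to \<open>g\<close>. For v =
  \<infinity> the pointwise estimate of \<open>g\<close> is enough; for finite v it controls the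
  surplus power \<open>V - Q\<close>, and the remaining power \<open>Q\<close> is integrated through
  the majorant.\<close>

lemma weighted_rearrangement_norm_upper:
  fixes \<Omega> :: "'a::euclidean_space set" and q v :: ennreal
  assumes \<Omega>: "\<Omega> \<in> sets lebesgue" "emeasure lebesgue \<Omega> < \<infinity>" and P: "exponent_minus \<Omega> p = ereal P" "0 < P"
    and \<epsilon>: "0 < \<epsilon>" "\<epsilon> \<le> 1" and q: "0 < q" "q \<le> v" and bdd: "bounded (\<kappa> ` {0<..\<epsilon>})"
  shows "\<exists>c::real. 0 < c \<and> (\<forall>f\<in>variable_Lorentz_space \<Omega> p q.
    weighted_rearrangement_norm \<Omega> p \<epsilon> \<kappa> v f \<le> ennreal c * variable_Lorentz_norm \<Omega> p q f)"
proof -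
  obtain K where K: "0 < K" "\<And>t. t \<in> {0<..\<epsilon>} \<Longrightarrow> \<kappa> t \<le> K"
    using bdd unfolding bounded_pos by (auto simp: abs_le_iff)
  define k where "k = (if q = \<infinity> then 1 else enn2real q powr (1 / enn2real q))"
  have k: "0 < k"
    using q by (auto simp: k_def enn2real_eq_0_iff)
  define g where "g f t = ennreal (t powr (1 / P)) * rearrangement \<Omega> f t" for f t
  have g: "g f t \<le> ennreal k * variable_Lorentz_norm \<Omega> p q f"
    if "f \<in> variable_Lorentz_space \<Omega> p q" "t \<in> {0<..\<epsilon>}" for f t
    unfolding g_def k_def
    using that \<epsilon> by (intro powr_mult_rearrangement_le assms) (auto simp: variable_Lorentz_space_def)
  have weight: "ennreal (\<kappa> t * t powr (1 / P)) * rearrangement \<Omega> f t \<le> ennreal K * g f t"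
    if "t \<in> {0<..\<epsilon>}" for f t
    unfolding g_def mult.assoc[symmetric] using K(1) K(2)[OF that]
    by (intro mult_right_mono) (auto simp: mult_right_mono intro!: ennreal_leI simp flip: ennreal_mult)
  show ?thesis
  proof (cases v)
    case top
    show ?thesis
    proof (intro exI[of _ "K * k"] conjI ballI)
      show "0 < K * k" using K k by simp
      fix f assume f: "f \<in> variable_Lorentz_space \<Omega> p q"
      have "ennreal (\<kappa> t * t powr (1 / P)) * rearrangement \<Omega> f t \<le> ennreal (K * k) * variable_Lorentz_norm \<Omega> p q f"
        if "t \<in> {0<..<\<epsilon>}" for t
      proof -
        have t: "t \<in> {0<..\<epsilon>}" using that by auto
        have "ennreal K * g f t \<le> ennreal K * (ennreal k * variable_Lorentz_norm \<Omega> p q f)"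
          using g[OF f t] by (rule mult_left_mono) simp
        then show ?thesis
          using weight[OF t, of f] K k by (simp add: ennreal_mult mult.assoc)
      qed
      then show "weighted_rearrangement_norm \<Omega> p \<epsilon> \<kappa> v f \<le> ennreal (K * k) * variable_Lorentz_norm \<Omega> p q f"
        using top by (auto simp: weighted_rearrangement_norm_def P intro!: SUP_least)
    qed
  next
    case (real V)
    then have "q < \<infinity>"
      using q(2) by (auto intro: order_le_less_trans)
    then obtain Q where Q: "q = ennreal Q" "0 < Q"
      using q(1) by (cases q) auto
    have V: "Q \<le> V"
      using real q Q by (simp add: ennreal_le_iff)
    \<comment> \<open>The three factors come from the weight, the interpolation and the Tonelli
      estimate, arranged so that \<open>A * P * y powr Q = (c * y) powr V\<close>. This also holds
      for \<open>y = 0\<close>, because \<open>0 powr a = 0\<close> for every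
      \<open>a\<close>.\<close>
    define c where "c = (K powr V * k powr (V - Q) * P) powr (1 / V)"
    have c: "0 < c"
      using K k P by (simp add: c_def)
    show ?thesis
    proof (intro exI[of _ c] conjI ballI c)
      fix f assume f: "f \<in> variable_Lorentz_space \<Omega> p q"
      then obtain y where y: "0 \<le> y" "variable_Lorentz_norm \<Omega> p q f = ennreal y"
        unfolding variable_Lorentz_space_def by (cases "variable_Lorentz_norm \<Omega> p q f") auto
      obtain G where G: "G \<in> borel_measurable lborel"
        "\<And>t. t \<in> {0<..\<epsilon>} \<Longrightarrow> ennreal_powr (g f t) Q * ennreal (1 / t) \<le> G t"
        "(\<integral>\<^sup>+t. G t \<partial>lborel) \<le> ennreal P * Lorentz_integral \<Omega> p Q f"
        using rearrangement_integral_majorant[OF \<Omega> P _ \<epsilon> Q(2), of f] f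
        unfolding g_def variable_Lorentz_space_def by blast
      define A where "A = K powr V * (k * y) powr (V - Q)"
      have A: "0 \<le> A" by (simp add: A_def)
      have "(\<integral>\<^sup>+t\<in>{0<..\<epsilon>}. (ennreal_powr (ennreal (\<kappa> t * t powr (1 / P)) * rearrangement \<Omega> f t) V * ennreal (1 / t)) \<partial>lborel)
        \<le> (\<integral>\<^sup>+t. ennreal A * G t \<partial>lborel)"
      proof (rule nn_integral_mono)
        fix t :: real
        show "ennreal_powr (ennreal (\<kappa> t * t powr (1 / P)) * rearrangement \<Omega> f t) V * ennreal (1 / t) * indicator {0<..\<epsilon>} t
          \<le> ennreal A * G t"
        proof (cases "t \<in> {0<..\<epsilon>}")
          case t: True
          have "ennreal_powr (ennreal (\<kappa> t * t powr (1 / P)) * rearrangement \<Omega> f t) V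
            \<le> ennreal_powr (ennreal K * g f t) V"
            using weight[OF t] Q V by (intro ennreal_powr_mono) auto
          also have "\<dots> = ennreal (K powr V) * ennreal_powr (g f t) V"
            using K by (simp add: ennreal_powr_mult ennreal_powr_ennreal)
          also have "\<dots> \<le> ennreal (K powr V) * (ennreal ((k * y) powr (V - Q)) * ennreal_powr (g f t) Q)"
            using g[OF f t] y k Q V
            by (intro mult_left_mono ennreal_powr_interpolate) (auto simp: ennreal_mult)
          also have "\<dots> = ennreal A * ennreal_powr (g f t) Q"
            by (simp add: A_def ennreal_mult mult_ac)
          finally have "ennreal_powr (ennreal (\<kappa> t * t powr (1 / P)) * rearrangement \<Omega> f t) V * ennreal (1 / t)
            \<le> ennreal A * ennreal_powr (g f t) Q * ennreal (1 / t)"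
            by (rule mult_right_mono) simp
          also have "\<dots> \<le> ennreal A * G t"
            unfolding mult.assoc using G(2)[OF t] by (rule mult_left_mono) simp
          finally show ?thesis
            using t by simp
        qed simp
      qed
      also have "\<dots> = ennreal A * (\<integral>\<^sup>+t. G t \<partial>lborel)"
        using G(1) by (rule nn_integral_cmult)
      also have "\<dots> \<le> ennreal A * (ennreal P * Lorentz_integral \<Omega> p Q f)"
        using G(3) by (rule mult_left_mono) simp
      also have "\<dots> = ennreal (A * P * y powr Q)"
        using y Q A P by (simp add: Lorentz_integral_eq_powr ennreal_powr_ennreal ennreal_mult mult_ac)
      also have "A * P * y powr Q = (c * y) powr V"
      proof -
        have "(c * y) powr V = K powr V * k powr (V - Q) * P * y powr V"
          using K k P y Q V by (simp add: c_def powr_mult powr_powr)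
        also have "y powr V = y powr (V - Q) * y powr Q"
          by (simp flip: powr_add)
        finally show ?thesis
          using k y by (simp add: A_def powr_mult mult_ac)
      qed
      finally have "ennreal_powr (\<integral>\<^sup>+t\<in>{0<..\<epsilon>}. (ennreal_powr (ennreal (\<kappa> t * t powr (1 / P)) *
          rearrangement \<Omega> f t) V * ennreal (1 / t)) \<partial>lborel) (1 / V)
        \<le> ennreal_powr (ennreal ((c * y) powr V)) (1 / V)"
        using Q V by (intro ennreal_powr_mono) auto
      also have "\<dots> = ennreal c * ennreal y"
        using c y Q V by (simp add: ennreal_powr_ennreal powr_powr ennreal_mult)
      finally show "weighted_rearrangement_norm \<Omega> p \<epsilon> \<kappa> v f \<le> ennreal c * variable_Lorentz_norm \<Omega> p q f"
        using real y Q V by (simp add: weighted_rearrangement_norm_def P)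
    qed
  qed
qed

subsection \<open>Truncated powers\<close>

text \<open>For \<open>\<rho> = r\<close> this is a multiple of the indicator of the ball. Without
  truncation, and with \<open>a = n / P\<close>, the Lorentz integral would diverge logarithmically
  at large levels when q is finite.\<close>

definition truncated_power :: "'a::euclidean_space \<Rightarrow> real \<Rightarrow> real \<Rightarrow> real \<Rightarrow> 'a \<Rightarrow> real" where
  "truncated_power x0 a \<rho> r x = (if x \<in> ball x0 r then max (dist x0 x) \<rho> powr - a else 0)"

lemma less_powr_minus_iff:
  fixes z u a :: real
  assumes "0 < z" "0 < u" "0 < a"
  shows "u < z powr - a \<longleftrightarrow> z < u powr (- 1 / a)"
proof -
  have "u < z powr - a \<longleftrightarrow> ln u < - a * ln z"
    using assms by (subst ln_less_cancel_iff[symmetric]) (auto simp: ln_powr)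
  also have "\<dots> \<longleftrightarrow> ln z < - 1 / a * ln u"
    using assms by (auto simp: field_simps)
  also have "\<dots> \<longleftrightarrow> z < u powr (- 1 / a)"
    using assms by (subst ln_less_cancel_iff[symmetric]) (auto simp: ln_powr)
  finally show ?thesis .
qed

text \<open>The value exceeds \<open>u\<close> exactly when both the distance and \<rho> lie below
  \<open>u powr (- 1 / a)\<close>; the condition on \<rho> concerns \<open>u\<close> alone, and the
  one on the distance cuts out a ball.\<close>

lemma superlevel_truncated_power:
  assumes "ball x0 r \<subseteq> \<Omega>" "0 < \<rho>" "0 < a" "0 < u"
  shows "{x\<in>\<Omega>. \<bar>truncated_power x0 a \<rho> r x\<bar> > u}
    = (if u < \<rho> powr - a then ball x0 (min r (u powr (- 1 / a))) else {})"
proof -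
  have "u < max (dist x0 x) \<rho> powr - a \<longleftrightarrow> dist x0 x < u powr (- 1 / a) \<and> u < \<rho> powr - a" for x
    using assms less_powr_minus_iff[of "max (dist x0 x) \<rho>" u a] less_powr_minus_iff[of \<rho> u a] by auto
  then show ?thesis
    using assms by (auto simp: truncated_power_def)
qed

lemma truncated_power_measurable:
  fixes x0 :: "'a::euclidean_space"
  shows "truncated_power x0 a \<rho> r \<in> borel_measurable (lebesgue_on \<Omega>)"
proof -
  have "truncated_power x0 a \<rho> r \<in> borel_measurable borel"
    unfolding truncated_power_def mem_ball by measurable
  then show ?thesis
    by (intro measurable_restrict_space1 measurable_completion) simp
qed

text \<open>For finite q, levels below \<open>a\<close>, where the norm is at most
  \<open>M / a\<close>, contribute \<open>M powr Q / Q\<close>. Between \<open>a\<close> and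
  \<open>b\<close> the integrand is at most \<open>M powr Q / u\<close>, which gives the logarithm.
  Levels from \<open>b\<close> on contribute nothing.\<close>

lemma variable_Lorentz_norm_upper:
  assumes q: "0 < q" and M: "0 \<le> M" and ab: "0 < a" "a \<le> b"
    and N: "\<And>u. 0 < u \<Longrightarrow> u < b \<Longrightarrow> superlevel_norm \<Omega> p f u \<le> ennreal (M * min (1 / a) (1 / u))"
    and N0: "\<And>u. b \<le> u \<Longrightarrow> superlevel_norm \<Omega> p f u = 0"
  shows "variable_Lorentz_norm \<Omega> p q f
    \<le> ennreal (if q = \<infinity> then M else M * (1 / enn2real q + ln (b / a)) powr (1 / enn2real q))"
proof (cases q)
  case top
  have "ennreal u * superlevel_norm \<Omega> p f u \<le> ennreal M" if "0 < u" for u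
  proof (cases "u < b")
    case True
    have "ennreal u * superlevel_norm \<Omega> p f u \<le> ennreal u * ennreal (M * min (1 / a) (1 / u))"
      using N[OF that True] by (rule mult_left_mono) simp
    also have "\<dots> = ennreal (u * (M * min (1 / a) (1 / u)))"
      using that ab M by (simp flip: ennreal_mult)
    also have "\<dots> \<le> ennreal (u * (M * (1 / u)))"
      using that M by (intro ennreal_leI mult_left_mono) auto
    finally show ?thesis
      using that by simp
  qed (simp add: N0)
  then have "variable_Lorentz_norm \<Omega> p \<infinity> f \<le> ennreal M"
    unfolding variable_Lorentz_norm_top by (intro SUP_least) auto
  then show ?thesis
    using top by simp
next
  case (real Q)
  then have Q: "0 < Q" using q by (simp add: order_less_le)
  have "Lorentz_integral \<Omega> p Q f \<le> (\<integral>\<^sup>+u. ennreal (M powr Q * a powr - Q) * (ennreal (u powr (Q - 1)) * indicator {0..a} u)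
      + ennreal (M powr Q) * (ennreal (1 / u) * indicator {a..b} u) \<partial>lborel)"
    unfolding Lorentz_integral_def
  proof (rule nn_integral_mono)
    fix u :: real
    let ?l = "ennreal (u powr Q) * ennreal_powr (superlevel_norm \<Omega> p f u) Q * ennreal (1 / u) * indicator {0<..} u"
    let ?r1 = "ennreal (M powr Q * a powr - Q) * (ennreal (u powr (Q - 1)) * indicator {0..a} u)"
    let ?r2 = "ennreal (M powr Q) * (ennreal (1 / u) * indicator {a..b} u)"
    have bound: "?l \<le> ennreal (u powr Q * (M * c) powr Q * (1 / u))"
      if "superlevel_norm \<Omega> p f u \<le> ennreal (M * c)" "0 < c" "0 < u" for c
    proof -
      have "ennreal_powr (superlevel_norm \<Omega> p f u) Q \<le> ennreal_powr (ennreal (M * c)) Q"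
        using that Q by (intro ennreal_powr_mono) auto
      also have "\<dots> = ennreal ((M * c) powr Q)"
        using M that by (simp add: ennreal_powr_ennreal)
      finally have "ennreal (u powr Q) * ennreal_powr (superlevel_norm \<Omega> p f u) Q * ennreal (1 / u)
        \<le> ennreal (u powr Q) * ennreal ((M * c) powr Q) * ennreal (1 / u)"
        by (intro mult_left_mono mult_right_mono) auto
      also have "\<dots> = ennreal (u powr Q * (M * c) powr Q * (1 / u))"
        using that by (simp flip: ennreal_mult)
      finally show ?thesis
        using that by simp
    qed
    consider "u \<le> 0" | "0 < u" "u < a" | "a \<le> u" "0 < u" "u < b" | "b \<le> u" "0 < u"
      by linarith
    then show "?l \<le> ?r1 + ?r2"
    proof cases
      case 2
      then have "superlevel_norm \<Omega> p f u \<le> ennreal (M * (1 / a))"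
        using N[of u] ab by (simp add: min_def field_simps)
      then have "?l \<le> ennreal (u powr Q * (M * (1 / a)) powr Q * (1 / u))"
        using 2 ab by (intro bound) auto
      also have "u powr Q * (M * (1 / a)) powr Q * (1 / u) = M powr Q * a powr - Q * u powr (Q - 1)"
        using M ab 2 by (simp add: powr_mult powr_divide powr_minus_divide powr_diff)
      also have "ennreal \<dots> = ?r1"
        using 2 by (simp add: ennreal_mult)
      finally show ?thesis
        by (rule order_trans) simp
    next
      case 3
      then have "superlevel_norm \<Omega> p f u \<le> ennreal (M * (1 / u))"
        using N[of u] ab by (simp add: min_def field_simps split: if_splits)
      then have "?l \<le> ennreal (u powr Q * (M * (1 / u)) powr Q * (1 / u))"
        using 3 by (intro bound) auto
      also have "u powr Q * (M * (1 / u)) powr Q * (1 / u) = M powr Q * (1 / u)"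
        using M 3 by (simp add: powr_mult powr_divide)
      also have "ennreal \<dots> = ?r2"
        using 3 by (simp flip: ennreal_mult)
      finally show ?thesis
        by (rule order_trans) simp
    next
      case 4
      then show ?thesis
        using Q by (simp add: N0 ennreal_powr_def)
    qed simp
  qed
  also have "\<dots> = ennreal (M powr Q * a powr - Q) * ennreal (a powr Q / Q) + ennreal (M powr Q) * ennreal (ln (b / a))"
    using Q ab by (simp add: nn_integral_add nn_integral_cmult nn_integral_powr_Icc_0 nn_integral_inverse_Icc)
  also have "\<dots> = ennreal (M powr Q * (1 / Q + ln (b / a)))"
  proof -
    have "M powr Q * a powr - Q * (a powr Q / Q) + M powr Q * ln (b / a) = M powr Q * (1 / Q + ln (b / a))"
      using ab by (simp add: powr_minus_divide field_simps)
    then show ?thesis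
      using Q ab by (simp flip: ennreal_mult ennreal_plus)
  qed
  finally have "ennreal_powr (Lorentz_integral \<Omega> p Q f) (1 / Q)
    \<le> ennreal_powr (ennreal (M powr Q * (1 / Q + ln (b / a)))) (1 / Q)"
    using Q by (intro ennreal_powr_mono) auto
  also have "\<dots> = ennreal (M * (1 / Q + ln (b / a)) powr (1 / Q))"
    using Q M ab by (simp add: ennreal_powr_ennreal powr_mult powr_powr)
  finally show ?thesis
    using real Q by (simp add: variable_Lorentz_norm_ennreal)
qed

text \<open>The superlevel sets are balls, so their norms are at most
  \<open>M * min (r powr (n / P)) (1 / u)\<close>, and the previous estimate applies with levels
  \<open>r powr - (n / P)\<close> and \<open>\<rho> powr - (n / P)\<close>. The bound is phrased
  through \<open>ln 2 + n * ln (r / \<rho>)\<close> to match the logarithmic length of the interval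
  on which f* is bounded below.\<close>

lemma variable_Lorentz_norm_truncated_power:
  fixes \<Omega> :: "'a::euclidean_space set"
  defines "n \<equiv> real DIM('a)"
  assumes \<Omega>: "\<Omega> \<in> sets lebesgue" and P: "exponent_minus \<Omega> p = ereal P" "0 < P"
    and x0: "p x0 = P" "log_Hoelder_at \<Omega> x0 p" and q: "0 < q"
  shows "\<exists>K>0. \<forall>\<rho> r. 0 < \<rho> \<and> \<rho> \<le> r \<and> r < 1/2 \<and> ball x0 r \<subseteq> \<Omega> \<longrightarrow>
    variable_Lorentz_norm \<Omega> p q (truncated_power x0 (n / P) \<rho> r)
      \<le> ennreal (K * (ln 2 + n * ln (r / \<rho>)) powr (1 / enn2real q))"
proof -
  obtain M where M: "0 < M" "\<And>r. 0 < r \<Longrightarrow> r < 1/2 \<Longrightarrow> ball x0 r \<subseteq> \<Omega> \<Longrightarrow>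
    variable_Lebesgue_norm \<Omega> p (indicat_real (ball x0 r)) \<le> ennreal (M * r powr (n / P))"
    using variable_Lebesgue_norm_ball_upper[OF \<Omega> P x0] unfolding n_def by blast
  have n: "0 < n" by (simp add: n_def)
  define Q where "Q = enn2real q"
  \<comment> \<open>Chosen so that \<open>1 / Q \<le> R * ln 2\<close> and
    \<open>1 / P \<le> R\<close>, which compares the two logarithmic expressions term by
    term.\<close>
  define R where "R = max (1 / (Q * ln 2)) (1 / P)"
  define K where "K = (if q = \<infinity> then M else M * R powr (1 / Q))"
  have R: "0 < R"
    using P by (simp add: R_def less_max_iff_disj)
  show ?thesis
  proof (intro exI[of _ K] conjI allI impI)
    show "0 < K" using M R by (simp add: K_def)
    fix \<rho> r assume \<rho>r: "0 < \<rho> \<and> \<rho> \<le> r \<and> r < 1/2 \<and> ball x0 r \<subseteq> \<Omega>"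
    define f where "f = truncated_power x0 (n / P) \<rho> r"
    have level: "{x\<in>\<Omega>. \<bar>f x\<bar> > u} = (if u < \<rho> powr - (n / P) then ball x0 (min r (u powr (- 1 / (n / P)))) else {})"
      if "0 < u" for u
      unfolding f_def using \<rho>r n P that by (intro superlevel_truncated_power) auto
    have norm: "variable_Lorentz_norm \<Omega> p q f \<le>
      ennreal (if q = \<infinity> then M else M * (1 / enn2real q + ln (\<rho> powr - (n / P) / r powr - (n / P))) powr (1 / enn2real q))"
    proof (intro variable_Lorentz_norm_upper q less_imp_le[OF M(1)])
      show "0 < r powr - (n / P)" using \<rho>r by simp
      show "r powr - (n / P) \<le> \<rho> powr - (n / P)"
        using \<rho>r n P by (intro powr_mono2') auto
    next
      fix u assume u: "0 < u" "u < \<rho> powr - (n / P)"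
      define s where "s = min r (u powr (- 1 / (n / P)))"
      have s: "0 < s" "s < 1/2" "ball x0 s \<subseteq> \<Omega>"
        using \<rho>r u by (auto simp: s_def)
      have "superlevel_norm \<Omega> p f u \<le> ennreal (M * s powr (n / P))"
        using level[OF u(1)] u M(2)[OF s] by (simp add: superlevel_norm_def s_def)
      also have "s powr (n / P) = min (r powr (n / P)) (1 / u)"
      proof -
        have "s powr (n / P) = min (r powr (n / P)) ((u powr (- 1 / (n / P))) powr (n / P))"
        proof (cases "r \<le> u powr (- 1 / (n / P))")
          case True
          then have "r powr (n / P) \<le> (u powr (- 1 / (n / P))) powr (n / P)"
            using \<rho>r n P by (intro powr_mono2) auto
          then show ?thesis
            using True by (simp only: s_def min_absorb1)
        next
          case False
          then have "(u powr (- 1 / (n / P))) powr (n / P) \<le> r powr (n / P)"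
            using n P by (intro powr_mono2) auto
          then show ?thesis
            using False by (simp only: s_def min_absorb2 linear not_le less_imp_le)
        qed
        also have "(u powr (- 1 / (n / P))) powr (n / P) = 1 / u"
          using n P u by (simp only: powr_powr) (simp add: powr_minus_divide)
        finally show ?thesis .
      qed
      finally show "superlevel_norm \<Omega> p f u \<le> ennreal (M * min (1 / r powr - (n / P)) (1 / u))"
        using \<rho>r by (simp add: powr_minus_divide)
    next
      fix u assume u: "\<rho> powr - (n / P) \<le> u"
      then have "0 < u"
        using \<rho>r by (intro order_less_le_trans[OF _ u]) auto
      then show "superlevel_norm \<Omega> p f u = 0"
        using level u by (simp add: superlevel_norm_def)
    qed
    have lnq: "ln (\<rho> powr - (n / P) / r powr - (n / P)) = n / P * ln (r / \<rho>)"
      using \<rho>r by (simp add: ln_div ln_powr algebra_simps)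
    have L: "0 \<le> ln (r / \<rho>)"
      using \<rho>r by simp
    have le: "M * (1 / Q + n / P * ln (r / \<rho>)) powr (1 / Q) \<le> K * (ln 2 + n * ln (r / \<rho>)) powr (1 / Q)" if "q \<noteq> \<infinity>"
    proof -
      have Q: "0 < Q"
        using q that by (auto simp: Q_def enn2real_positive_iff less_top)
      have "1 / Q = 1 / (Q * ln 2) * ln 2" by simp
      also have "\<dots> \<le> R * ln 2"
        by (intro mult_right_mono) (auto simp: R_def)
      moreover have "1 / P * (n * ln (r / \<rho>)) \<le> R * (n * ln (r / \<rho>))"
        using n L by (intro mult_right_mono) (auto simp: R_def)
      ultimately have "1 / Q + n / P * ln (r / \<rho>) \<le> R * (ln 2 + n * ln (r / \<rho>))"
        by (simp add: algebra_simps)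
      then have "(1 / Q + n / P * ln (r / \<rho>)) powr (1 / Q) \<le> (R * (ln 2 + n * ln (r / \<rho>))) powr (1 / Q)"
        using Q n P L by (intro powr_mono2) auto
      also have "\<dots> = R powr (1 / Q) * (ln 2 + n * ln (r / \<rho>)) powr (1 / Q)"
        using R n L by (simp add: powr_mult)
      finally show ?thesis
        using M that by (simp add: K_def)
    qed
    \<comment> \<open>For q = \<infinity> the exponent \<open>1 / enn2real q\<close> is 0 by the
      conventions for \<open>enn2real\<close> and division; positivity of the base then makes the
      power equal to 1 rather than 0.\<close>
    have "ln 2 + n * ln (r / \<rho>) > 0"
      using n L by (intro add_pos_nonneg) auto
    then have "(if q = \<infinity> then M else M * (1 / Q + n / P * ln (r / \<rho>)) powr (1 / Q))
      \<le> K * (ln 2 + n * ln (r / \<rho>)) powr (1 / Q)"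
      using le by (auto simp: K_def Q_def)
    then show "variable_Lorentz_norm \<Omega> p q (truncated_power x0 (n / P) \<rho> r)
      \<le> ennreal (K * (ln 2 + n * ln (r / \<rho>)) powr (1 / enn2real q))"
      using norm unfolding lnq f_def Q_def by (meson ennreal_leI order_trans)
  qed
qed

text \<open>An admissible level \<open>s\<close> at or above the maximum
  \<open>\<rho> powr - (n / P)\<close> is large enough by the lower bound on \<open>t\<close>. A
  smaller one has a ball as superlevel set, whose volume is at most \<open>t\<close>, and this
  bounds \<open>s\<close> from below through its radius.\<close>

lemma rearrangement_truncated_power_lower:
  fixes \<Omega> :: "'a::euclidean_space set"
  defines "n \<equiv> real DIM('a)"
  defines "w \<equiv> unit_ball_vol n"
  assumes P: "0 < P" and \<rho>r: "0 < \<rho>" "\<rho> \<le> r" "ball x0 r \<subseteq> \<Omega>"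
    and t: "w / 4 * \<rho> powr n \<le> t" "t < w * r powr n"
  shows "ennreal ((w / 4) powr (1 / P)) \<le> ennreal (t powr (1 / P)) * rearrangement \<Omega> (truncated_power x0 (n / P) \<rho> r) t"
proof -
  have n: "0 < n" and w: "0 < w"
    by (auto simp: n_def w_def)
  have t0: "0 < t"
    using t(1) w \<rho>r by (intro order_less_le_trans[OF _ t(1)]) auto
  define f where "f = truncated_power x0 (n / P) \<rho> r"
  have "ennreal ((w / 4 / t) powr (1 / P)) \<le> rearrangement \<Omega> f t"
    unfolding rearrangement_def
  proof (safe intro!: INF_greatest ennreal_leI)
    fix s :: real
    assume s: "0 < s" "emeasure lebesgue {x\<in>\<Omega>. \<bar>f x\<bar> > s} \<le> ennreal t"
    have level: "{x\<in>\<Omega>. \<bar>f x\<bar> > s} = (if s < \<rho> powr - (n / P) then ball x0 (min r (s powr (- 1 / (n / P)))) else {})"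
      unfolding f_def using \<rho>r n P s by (intro superlevel_truncated_power) auto
    show "(w / 4 / t) powr (1 / P) \<le> s"
    proof (cases "s < \<rho> powr - (n / P)")
      case False
      have "w / 4 / t \<le> \<rho> powr - n"
        using t(1) t0 \<rho>r by (simp add: field_simps powr_minus_divide)
      then have "(w / 4 / t) powr (1 / P) \<le> (\<rho> powr - n) powr (1 / P)"
        using w t0 P by (intro powr_mono2) auto
      also have "\<dots> = \<rho> powr - (n / P)"
        by (simp add: powr_powr)
      finally show ?thesis
        using False by simp
    next
      case True
      define m where "m = min r (s powr (- 1 / (n / P)))"
      have m: "0 < m" using \<rho>r s by (simp add: m_def)
      have "ennreal (w * m powr n) = emeasure lebesgue (ball x0 m)"
        using m emeasure_lebesgue_ball[of m x0] by (simp add: w_def n_def powr_realpow)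
      also have "\<dots> \<le> ennreal t"
        using s(2) unfolding level m_def using True by (simp only: if_True)
      finally have "ennreal (w * m powr n) \<le> ennreal t" .
      then have mt: "w * m powr n \<le> t"
        using t0 by (simp add: ennreal_le_iff)
      \<comment> \<open>The full ball of radius \<open>r\<close> has volume
        \<open>w * r powr n > t\<close>, so the minimum is attained by the radius depending on
        \<open>s\<close>.\<close>
      have "m \<noteq> r"
        using mt t(2) by auto
      then have "m = s powr (- 1 / (n / P))"
        by (auto simp: m_def min_def split: if_splits)
      then have "m powr n = s powr - P"
        using n P by (simp add: powr_powr)
      then have "m powr n = 1 / s powr P"
        by (simp only: powr_minus_divide)
      then have "w / s powr P \<le> t"
        using mt by simp
      then have "w / t \<le> s powr P"
        using s t0 by (simp add: field_simps)
      moreover have "w / 4 / t \<le> w / t"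
        using w t0 by (simp add: field_simps)
      ultimately have "(w / 4 / t) powr (1 / P) \<le> (s powr P) powr (1 / P)"
        using w t0 P by (intro powr_mono2) auto
      then show ?thesis
        using P s by (simp add: powr_powr)
    qed
  qed
  then have "ennreal (t powr (1 / P)) * ennreal ((w / 4 / t) powr (1 / P)) \<le> ennreal (t powr (1 / P)) * rearrangement \<Omega> f t"
    by (rule mult_left_mono) simp
  moreover have "t powr (1 / P) * (w / 4 / t) powr (1 / P) = (w / 4) powr (1 / P)"
    using t0 w by (simp flip: powr_mult)
  ultimately show ?thesis
    by (simp add: f_def flip: ennreal_mult)
qed

subsection \<open>Necessity of the conditions\<close>

text \<open>On [a, b] the integrand is at least \<open>B powr V / t\<close>, which integrates to
  \<open>B powr V * ln (b / a)\<close>.\<close>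

lemma weighted_rearrangement_norm_lower:
  assumes P: "exponent_minus \<Omega> p = ereal P" and V: "0 < V"
    and ab: "0 < a" "a \<le> b" "b \<le> \<epsilon>" and B: "0 \<le> B"
    and le: "\<And>t. a \<le> t \<Longrightarrow> t \<le> b \<Longrightarrow> ennreal B \<le> ennreal (\<kappa> t * t powr (1 / P)) * rearrangement \<Omega> f t"
  shows "ennreal (B * ln (b / a) powr (1 / V)) \<le> weighted_rearrangement_norm \<Omega> p \<epsilon> \<kappa> (ennreal V) f"
proof -
  have "ennreal (B powr V * ln (b / a)) = ennreal (B powr V) * ennreal (ln (b / a))"
    using ab by (simp add: ennreal_mult)
  also have "\<dots> = (\<integral>\<^sup>+t. ennreal (B powr V) * (ennreal (1 / t) * indicator {a..b} t) \<partial>lborel)"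
    using ab by (simp add: nn_integral_cmult nn_integral_inverse_Icc)
  also have "\<dots> \<le> (\<integral>\<^sup>+t\<in>{0<..\<epsilon>}. (ennreal_powr (ennreal (\<kappa> t * t powr (1 / P)) * rearrangement \<Omega> f t) V
      * ennreal (1 / t)) \<partial>lborel)"
  proof (rule nn_integral_mono)
    fix t :: real
    show "ennreal (B powr V) * (ennreal (1 / t) * indicator {a..b} t)
      \<le> ennreal_powr (ennreal (\<kappa> t * t powr (1 / P)) * rearrangement \<Omega> f t) V * ennreal (1 / t) * indicator {0<..\<epsilon>} t"
    proof (cases "a \<le> t \<and> t \<le> b")
      case True
      then have "ennreal_powr (ennreal B) V \<le> ennreal_powr (ennreal (\<kappa> t * t powr (1 / P)) * rearrangement \<Omega> f t) V"
        using V le by (intro ennreal_powr_mono) auto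
      then have "ennreal (B powr V) * ennreal (1 / t) \<le>
        ennreal_powr (ennreal (\<kappa> t * t powr (1 / P)) * rearrangement \<Omega> f t) V * ennreal (1 / t)"
        using B by (intro mult_right_mono) (auto simp: ennreal_powr_ennreal)
      then show ?thesis
        using True ab by simp
    qed auto
  qed
  finally have "ennreal_powr (ennreal (B powr V * ln (b / a))) (1 / V)
    \<le> ennreal_powr (\<integral>\<^sup>+t\<in>{0<..\<epsilon>}. (ennreal_powr (ennreal (\<kappa> t * t powr (1 / P)) * rearrangement \<Omega> f t) V
      * ennreal (1 / t)) \<partial>lborel) (1 / V)"
    using V by (intro ennreal_powr_mono) auto
  moreover have "ennreal_powr (ennreal (B powr V * ln (b / a))) (1 / V) = ennreal (B * ln (b / a) powr (1 / V))"
    using V B ab by (simp add: ennreal_powr_ennreal powr_mult powr_powr)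
  ultimately show ?thesis
    using V by (simp add: weighted_rearrangement_norm_def P)
qed

lemma powr_dominated_imp_le:
  fixes A B \<alpha> \<beta> x1 :: real
  assumes "0 < A" "0 < x1" and le: "\<And>x. x1 \<le> x \<Longrightarrow> A * x powr \<alpha> \<le> B * x powr \<beta>"
  shows "\<alpha> \<le> \<beta>"
proof (rule ccontr)
  assume "\<not> \<alpha> \<le> \<beta>"
  define \<delta> where "\<delta> = \<alpha> - \<beta>"
  have \<delta>: "0 < \<delta>" using \<open>\<not> \<alpha> \<le> \<beta>\<close> by (simp add: \<delta>_def)
  \<comment> \<open>With this choice \<open>A * y = \<bar>B\<bar> + A\<close> exceeds
    \<open>B\<close>, while \<open>x\<close> below is large enough for
    \<open>x powr \<delta> \<ge> y\<close>.\<close>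
  define y where "y = \<bar>B\<bar> / A + 1"
  have y: "0 < y" using assms by (simp add: y_def add_nonneg_pos)
  define x where "x = max x1 (y powr (1 / \<delta>))"
  have x: "0 < x" "x1 \<le> x" using assms by (auto simp: x_def)
  have "A * x powr \<delta> * x powr \<beta> \<le> B * x powr \<beta>"
    using le[OF x(2)] by (simp add: \<delta>_def mult.assoc flip: powr_add)
  then have "A * x powr \<delta> \<le> B"
    using x by simp
  moreover have "(y powr (1 / \<delta>)) powr \<delta> \<le> x powr \<delta>"
    using \<delta> by (intro powr_mono2) (auto simp: x_def)
  then have "y \<le> x powr \<delta>"
    using y \<delta> by (simp add: powr_powr)
  then have "A * y \<le> A * x powr \<delta>"
    using assms by simp
  moreover have "A * y = \<bar>B\<bar> + A"
    using assms by (simp add: y_def field_simps)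
  ultimately show False
    using assms by linarith
qed

section \<open>Testing the inequality on truncated powers centred at \<open>x0\<close>\<close>

context
  fixes \<Omega> :: "'a::euclidean_space set" and p :: "'a \<Rightarrow> real" and P :: real and x0 :: 'a and q :: ennreal
    and n w r0 \<epsilon> :: real
  defines "n \<equiv> real DIM('a)" and "w \<equiv> unit_ball_vol (real DIM('a))"
  assumes \<Omega>: "\<Omega> \<in> sets lebesgue" and P: "exponent_minus \<Omega> p = ereal P" "0 < P"
    and x0: "p x0 = P" "log_Hoelder_at \<Omega> x0 p" and q: "0 < q"
    and r0: "0 < r0" "r0 < 1/2" "ball x0 r0 \<subseteq> \<Omega>" and \<epsilon>: "0 < \<epsilon>" "\<epsilon> \<le> w / 2 * r0 powr n"
begin

text \<open>The point is that \<open>C\<close> is uniform in \<rho> and \<open>r\<close>: one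
  parameter can be tied to \<open>t\<close> while the other varies freely.\<close>

lemma embedding_truncated_power:
  assumes c: "0 < c" "\<And>f. f \<in> variable_Lorentz_space \<Omega> p q \<Longrightarrow>
    weighted_rearrangement_norm \<Omega> p \<epsilon> \<kappa> v f \<le> ennreal c * variable_Lorentz_norm \<Omega> p q f"
  shows "\<exists>C>0. \<forall>\<rho> r. 0 < \<rho> \<and> \<rho> \<le> r \<and> r \<le> r0 \<longrightarrow>
    weighted_rearrangement_norm \<Omega> p \<epsilon> \<kappa> v (truncated_power x0 (n / P) \<rho> r)
      \<le> ennreal (C * (ln 2 + n * ln (r / \<rho>)) powr (1 / enn2real q))"
proof -
  obtain K where K: "0 < K" "\<And>\<rho> r. 0 < \<rho> \<Longrightarrow> \<rho> \<le> r \<Longrightarrow> r < 1/2 \<Longrightarrow> ball x0 r \<subseteq> \<Omega> \<Longrightarrow>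
    variable_Lorentz_norm \<Omega> p q (truncated_power x0 (n / P) \<rho> r)
      \<le> ennreal (K * (ln 2 + n * ln (r / \<rho>)) powr (1 / enn2real q))"
    using variable_Lorentz_norm_truncated_power[OF \<Omega> P x0 q] unfolding n_def by blast
  show ?thesis
  proof (intro exI[of _ "c * K"] conjI allI impI)
    show "0 < c * K" using c K by simp
    fix \<rho> r assume \<rho>r: "0 < \<rho> \<and> \<rho> \<le> r \<and> r \<le> r0"
    let ?f = "truncated_power x0 (n / P) \<rho> r"
    have norm: "variable_Lorentz_norm \<Omega> p q ?f \<le> ennreal (K * (ln 2 + n * ln (r / \<rho>)) powr (1 / enn2real q))"
      using \<rho>r r0 subset_ball[of r r0 x0] by (intro K) auto
    then have "variable_Lorentz_norm \<Omega> p q ?f < \<infinity>"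
      by (rule order_le_less_trans) simp
    then have "?f \<in> variable_Lorentz_space \<Omega> p q"
      by (simp add: variable_Lorentz_space_def truncated_power_measurable)
    then have "weighted_rearrangement_norm \<Omega> p \<epsilon> \<kappa> v ?f \<le> ennreal c * variable_Lorentz_norm \<Omega> p q ?f"
      by (rule c)
    also have "\<dots> \<le> ennreal c * ennreal (K * (ln 2 + n * ln (r / \<rho>)) powr (1 / enn2real q))"
      using norm by (rule mult_left_mono) simp
    also have "\<dots> = ennreal (c * K * (ln 2 + n * ln (r / \<rho>)) powr (1 / enn2real q))"
      using c K by (simp add: mult.assoc flip: ennreal_mult)
    finally show "weighted_rearrangement_norm \<Omega> p \<epsilon> \<kappa> v ?f
      \<le> ennreal (c * K * (ln 2 + n * ln (r / \<rho>)) powr (1 / enn2real q))" .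
  qed
qed

text \<open>The smallness of \<epsilon> fixed in the context is what keeps the radius within
  \<open>r0\<close>. Half the volume of the ball is used so that \<open>t\<close> stays strictly
  below the full volume.\<close>

lemma radius_of_volume:
  assumes "0 < t" "t \<le> \<epsilon>"
  obtains r where "0 < r" "r \<le> r0" "w / 2 * r powr n = t"
proof -
  have n: "0 < n" and w: "0 < w"
    by (auto simp: n_def w_def)
  define r where "r = (2 * t / w) powr (1 / n)"
  have r: "0 < r" "w / 2 * r powr n = t"
    using assms n w by (auto simp: r_def powr_powr)
  moreover have "r \<le> r0"
  proof (rule ccontr)
    assume "\<not> r \<le> r0"
    then have "r0 powr n < r powr n"
      using r0 n by (intro powr_less_mono2) auto
    then have "w / 2 * r0 powr n < w / 2 * r powr n"
      using w by simp
    then show False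
      using r assms \<epsilon> by simp
  qed
  ultimately show thesis
    using that by blast
qed

text \<open>The bound \<open>k\<close> is kept separate from the weight at \<open>t\<close> so that,
  for a decreasing weight, its value at the right end of an interval serves for the whole
  interval.\<close>

lemma weighted_truncated_power_lower:
  assumes \<rho>r: "0 < \<rho>" "\<rho> \<le> r" "r \<le> r0" and \<kappa>: "0 \<le> k" "k \<le> \<kappa> t"
    and t: "w / 4 * \<rho> powr n \<le> t" "t \<le> w / 2 * r powr n"
  shows "ennreal (k * (w / 4) powr (1 / P)) \<le>
    ennreal (\<kappa> t * t powr (1 / P)) * rearrangement \<Omega> (truncated_power x0 (n / P) \<rho> r) t"
proof -
  have w: "0 < w" by (simp add: w_def)
  have "0 < r powr n" using \<rho>r by simp
  then have "w / 2 * r powr n < w * r powr n"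
    using w by simp
  with t(2) have "t < w * r powr n"
    by linarith
  then have *: "ennreal ((w / 4) powr (1 / P)) \<le>
    ennreal (t powr (1 / P)) * rearrangement \<Omega> (truncated_power x0 (n / P) \<rho> r) t"
    using t(1) \<rho>r P r0 subset_ball[of r r0 x0] unfolding n_def w_def
    by (intro rearrangement_truncated_power_lower) auto
  have "ennreal (k * (w / 4) powr (1 / P)) = ennreal k * ennreal ((w / 4) powr (1 / P))"
    using \<kappa> by (simp add: ennreal_mult)
  also have "\<dots> \<le> ennreal (\<kappa> t) *
      (ennreal (t powr (1 / P)) * rearrangement \<Omega> (truncated_power x0 (n / P) \<rho> r) t)"
    using * \<kappa> by (intro mult_mono ennreal_leI) auto
  also have "\<dots> = ennreal (\<kappa> t * t powr (1 / P)) * rearrangement \<Omega> (truncated_power x0 (n / P) \<rho> r) t"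
    using \<kappa> by (simp add: ennreal_mult mult.assoc)
  finally show ?thesis .
qed

lemma sup_embedding_imp_bounded:
  assumes \<kappa>: "\<And>t. t \<in> {0<..\<epsilon>} \<Longrightarrow> 0 \<le> \<kappa> t"
    and c: "0 < c" "\<And>f. f \<in> variable_Lorentz_space \<Omega> p q \<Longrightarrow>
      weighted_rearrangement_norm \<Omega> p \<epsilon> \<kappa> \<infinity> f \<le> ennreal c * variable_Lorentz_norm \<Omega> p q f"
  shows "bounded (\<kappa> ` {0<..\<epsilon>})"
proof -
  have w: "0 < w" by (simp add: w_def)
  obtain C where C: "0 < C" "\<And>\<rho> r. 0 < \<rho> \<Longrightarrow> \<rho> \<le> r \<Longrightarrow> r \<le> r0 \<Longrightarrow>
    weighted_rearrangement_norm \<Omega> p \<epsilon> \<kappa> \<infinity> (truncated_power x0 (n / P) \<rho> r)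
      \<le> ennreal (C * (ln 2 + n * ln (r / \<rho>)) powr (1 / enn2real q))"
    using embedding_truncated_power[OF c] by blast
  define D where "D = C * ln 2 powr (1 / enn2real q) / (w / 4) powr (1 / P)"
  have "\<kappa> t \<le> D" if t: "0 < t" "t < \<epsilon>" for t
  proof -
    obtain r where r: "0 < r" "r \<le> r0" "w / 2 * r powr n = t"
      using t radius_of_volume[of t] by auto
    \<comment> \<open>With equal radii the logarithm of their quotient vanishes, so the right-hand
      side is a constant independent of \<open>t\<close>.\<close>
    let ?f = "truncated_power x0 (n / P) r r"
    have "ennreal (\<kappa> t * (w / 4) powr (1 / P)) \<le> ennreal (\<kappa> t * t powr (1 / P)) * rearrangement \<Omega> ?f t"
      using r w t \<kappa> by (intro weighted_truncated_power_lower) auto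
    also have "\<dots> \<le> weighted_rearrangement_norm \<Omega> p \<epsilon> \<kappa> \<infinity> ?f"
      using t by (auto simp: weighted_rearrangement_norm_def P intro!: SUP_upper2)
    also have "\<dots> \<le> ennreal (C * ln 2 powr (1 / enn2real q))"
      using C(2)[of r r] r by simp
    finally have "\<kappa> t * (w / 4) powr (1 / P) \<le> C * ln 2 powr (1 / enn2real q)"
      using C by (simp add: ennreal_le_iff)
    then show ?thesis
      using w by (simp add: D_def field_simps)
  qed
  \<comment> \<open>The supremum runs over the open interval and says nothing at \<epsilon>; the
    single value there is added by hand.\<close>
  then have "\<kappa> t \<le> max D (\<kappa> \<epsilon>)" if "t \<in> {0<..\<epsilon>}" for t
    using that by (cases "t = \<epsilon>") (auto intro: max.coboundedI1)
  then show ?thesis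
    using \<kappa> by (intro boundedI[of _ "max D (\<kappa> \<epsilon>)"]) auto
qed

text \<open>Both conclusions come from the inequality \<open>key\<close>, valid for all
  \<open>t\<close> and all \<open>x \<ge> ln 2\<close>. Fixing \<open>x = ln 2\<close> bounds the
  weight; fixing \<open>t = \<epsilon>\<close> and letting \<open>x\<close> grow compares the
  exponents \<open>1 / V\<close> and \<open>1 / enn2real q\<close>.\<close>

lemma integral_embedding_imp:
  assumes \<kappa>: "\<And>t. t \<in> {0<..\<epsilon>} \<Longrightarrow> 0 < \<kappa> t" "monotone_on {0<..\<epsilon>} (\<le>) (\<ge>) \<kappa>" and V: "0 < V"
    and c: "0 < c" "\<And>f. f \<in> variable_Lorentz_space \<Omega> p q \<Longrightarrow>
      weighted_rearrangement_norm \<Omega> p \<epsilon> \<kappa> (ennreal V) f \<le> ennreal c * variable_Lorentz_norm \<Omega> p q f"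
  shows "bounded (\<kappa> ` {0<..\<epsilon>})" and "q \<le> ennreal V"
proof -
  have n: "0 < n" and w: "0 < w"
    by (auto simp: n_def w_def)
  obtain C where C: "0 < C" "\<And>\<rho> r. 0 < \<rho> \<Longrightarrow> \<rho> \<le> r \<Longrightarrow> r \<le> r0 \<Longrightarrow>
    weighted_rearrangement_norm \<Omega> p \<epsilon> \<kappa> (ennreal V) (truncated_power x0 (n / P) \<rho> r)
      \<le> ennreal (C * (ln 2 + n * ln (r / \<rho>)) powr (1 / enn2real q))"
    using embedding_truncated_power[OF c] by blast
  have key: "\<kappa> t * (w / 4) powr (1 / P) * x powr (1 / V) \<le> C * x powr (1 / enn2real q)"
    if t: "t \<in> {0<..\<epsilon>}" and x: "ln 2 \<le> x" for t x
  proof -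
    obtain r where r: "0 < r" "r \<le> r0" "w / 2 * r powr n = t"
      using t radius_of_volume[of t] by auto
    \<comment> \<open>Solves \<open>ln 2 + n * ln (r / \<rho>) = x\<close>; the condition
      \<open>x \<ge> ln 2\<close> ensures \<open>\<rho> \<le> r\<close>.\<close>
    define \<rho> where "\<rho> = r * exp (- (x - ln 2) / n)"
    have "exp (- (x - ln 2) / n) \<le> 1"
      using x n by (simp add: divide_nonpos_pos)
    then have \<rho>: "0 < \<rho>" "\<rho> \<le> r"
      using r by (auto simp: \<rho>_def mult_left_le)
    have lnr: "ln 2 + n * ln (r / \<rho>) = x"
      using r n by (simp add: \<rho>_def ln_div ln_mult)
    let ?f = "truncated_power x0 (n / P) \<rho> r"
    have le: "w / 4 * \<rho> powr n \<le> w / 2 * r powr n"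
      using \<rho> n w by (intro mult_mono powr_mono2) auto
    \<comment> \<open>The endpoints \<open>w / 4 * \<rho> powr n\<close> and
      \<open>w / 2 * r powr n\<close> have quotient \<open>2 * (r / \<rho>) powr n\<close>, so the
      logarithmic length is the same \<open>x\<close> that appears in the upper bound.\<close>
    have "ln (w / 2 * r powr n / (w / 4 * \<rho> powr n)) = ln (2 * (r / \<rho>) powr n)"
      using w \<rho> r(1) by (simp add: powr_divide)
    also have "\<dots> = x"
      using \<rho> r lnr by (simp add: ln_mult ln_powr)
    finally have ln: "ln (w / 2 * r powr n / (w / 4 * \<rho> powr n)) = x" .
    have "ennreal (\<kappa> t * (w / 4) powr (1 / P) * x powr (1 / V)) \<le> weighted_rearrangement_norm \<Omega> p \<epsilon> \<kappa> (ennreal V) ?f"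
      unfolding ln[symmetric]
    proof (rule weighted_rearrangement_norm_lower[OF P(1) V _ le])
      show "0 < w / 4 * \<rho> powr n" "w / 2 * r powr n \<le> \<epsilon>" "0 \<le> \<kappa> t * (w / 4) powr (1 / P)"
        using w \<rho> r t \<kappa>(1)[OF t] by auto
      fix s assume s: "w / 4 * \<rho> powr n \<le> s" "s \<le> w / 2 * r powr n"
      have "0 < w / 4 * \<rho> powr n" using w \<rho> by simp
      then have "s \<in> {0<..\<epsilon>}" "s \<le> t"
        using s r t by auto
      then have "\<kappa> t \<le> \<kappa> s"
        using monotone_onD[OF \<kappa>(2) _ t] by simp
      then show "ennreal (\<kappa> t * (w / 4) powr (1 / P)) \<le> ennreal (\<kappa> s * s powr (1 / P)) * rearrangement \<Omega> ?f s"
        using \<rho> r s \<kappa>(1)[OF t] by (intro weighted_truncated_power_lower) auto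
    qed
    also have "\<dots> \<le> ennreal (C * x powr (1 / enn2real q))"
      using C(2)[of \<rho> r] \<rho> r unfolding lnr by simp
    finally show ?thesis
      using C by (simp add: ennreal_le_iff)
  qed
  define D where "D = C * ln 2 powr (1 / enn2real q) / ((w / 4) powr (1 / P) * ln 2 powr (1 / V))"
  have "\<kappa> t \<le> D" if "t \<in> {0<..\<epsilon>}" for t
    using key[OF that, of "ln 2"] w by (simp add: D_def field_simps)
  then show "bounded (\<kappa> ` {0<..\<epsilon>})"
    using \<kappa>(1) by (intro boundedI[of _ D]) (auto simp: less_imp_le)
  have "1 / V \<le> 1 / enn2real q"
  proof (rule powr_dominated_imp_le)
    show "0 < \<kappa> \<epsilon> * (w / 4) powr (1 / P)"
      using \<epsilon>(1) \<kappa>(1)[of \<epsilon>] w by simp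
    show "0 < ln (2::real)"
      by simp
    show "\<kappa> \<epsilon> * (w / 4) powr (1 / P) * x powr (1 / V) \<le> C * x powr (1 / enn2real q)" if "ln 2 \<le> x" for x
      using \<epsilon>(1) that by (intro key) simp_all
  qed
  \<comment> \<open>This excludes q = \<infinity>, for which \<open>1 / enn2real q\<close> is 0 by
    convention.\<close>
  moreover have "0 < 1 / V"
    using V by simp
  ultimately have "0 < 1 / enn2real q"
    by linarith
  then have Q: "0 < enn2real q"
    by simp
  then have "enn2real q \<le> V"
    using \<open>1 / V \<le> 1 / enn2real q\<close> V by (simp flip: inverse_eq_divide)
  then show "q \<le> ennreal V"
    using Q by (cases q) (auto intro: ennreal_leI)
qed

end

section \<open>Both equivalences for all small \<epsilon>\<close>

theorem corollary7p4:
  fixes \<Omega> :: "(real ^ 'd) set" and p :: "real ^ 'd \<Rightarrow> real" and q :: ennreal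
  assumes "open \<Omega>" and "emeasure lebesgue \<Omega> < \<infinity>"
    and "1 < q"
    and "p \<in> exponent_functions \<Omega>" and "exponent_plus \<Omega> p < \<infinity>"
    and "\<exists>x0\<in>\<Omega>. ereal (p x0) = exponent_minus \<Omega> p \<and> log_Hoelder_at \<Omega> x0 p"
  shows "\<exists>\<epsilon>0>0. \<forall>\<epsilon>. 0 < \<epsilon> \<and> \<epsilon> \<le> \<epsilon>0 \<longrightarrow>
    (\<forall>(\<kappa> :: real \<Rightarrow> real) (v :: ennreal).
       (\<forall>t\<in>{0<..\<epsilon>}. 0 < \<kappa> t) \<and> monotone_on {0<..\<epsilon>} (\<le>) (\<ge>) \<kappa> \<and> 0 < v \<longrightarrow>
       ((\<exists>c::real. 0 < c \<and> (\<forall>f\<in>variable_Lorentz_space \<Omega> p q.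
           weighted_rearrangement_norm \<Omega> p \<epsilon> \<kappa> v f \<le> ennreal c * variable_Lorentz_norm \<Omega> p q f))
        \<longleftrightarrow> bounded (\<kappa> ` {0<..\<epsilon>}) \<and> q \<le> v)) \<and>
    (\<forall>\<kappa> :: real \<Rightarrow> real.
       (\<forall>t\<in>{0<..\<epsilon>}. 0 \<le> \<kappa> t) \<longrightarrow>
       ((\<exists>c::real. 0 < c \<and> (\<forall>f\<in>variable_Lorentz_space \<Omega> p q.
           weighted_rearrangement_norm \<Omega> p \<epsilon> \<kappa> \<infinity> f \<le> ennreal c * variable_Lorentz_norm \<Omega> p q f))
        \<longleftrightarrow> bounded (\<kappa> ` {0<..\<epsilon>})))"
proof -
  obtain x0 where x0: "x0 \<in> \<Omega>" "ereal (p x0) = exponent_minus \<Omega> p" "log_Hoelder_at \<Omega> x0 p"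
    using assms(6) by blast
  define P where "P = p x0"
  have P: "exponent_minus \<Omega> p = ereal P" "0 < P"
    using x0 assms(4) by (auto simp: P_def exponent_functions_def)
  have \<Omega>: "\<Omega> \<in> sets lebesgue"
    using assms(1) by simp
  have q: "0 < q"
    using assms(3) by (rule order_less_trans[rotated]) simp
  obtain e where e: "0 < e" "ball x0 e \<subseteq> \<Omega>"
    using assms(1) x0(1) by (auto simp: open_contains_ball)
  \<comment> \<open>The radius stays below 1/2, the range of the log-Hoelder condition, and keeps
    the ball inside \<Omega>.\<close>
  define r0 where "r0 = min e (1 / 3)"
  have r0: "0 < r0" "r0 < 1/2" "ball x0 r0 \<subseteq> \<Omega>"
    using e subset_ball[of r0 e x0] by (auto simp: r0_def)
  \<comment> \<open>The bound 1 serves the sufficiency, where sets of measure at most 1 are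
    compared; the volume bound serves the necessity, where every \<open>t \<le> \<epsilon>\<close>
    must be half the volume of a ball of radius at most \<open>r0\<close>.\<close>
  define \<epsilon>0 where "\<epsilon>0 = min 1 (unit_ball_vol (real DIM(real ^ 'd)) / 2 * r0 powr real DIM(real ^ 'd))"
  show ?thesis
  proof (intro exI[of _ \<epsilon>0] conjI allI impI)
    show "0 < \<epsilon>0" using r0 by (simp add: \<epsilon>0_def)
  next
    fix \<epsilon> and v :: ennreal and \<kappa> :: "real \<Rightarrow> real"
    assume "0 < \<epsilon> \<and> \<epsilon> \<le> \<epsilon>0"
      and \<kappa>: "(\<forall>t\<in>{0<..\<epsilon>}. 0 < \<kappa> t) \<and> monotone_on {0<..\<epsilon>} (\<le>) (\<ge>) \<kappa> \<and> 0 < v"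
    then have \<epsilon>: "0 < \<epsilon>" "\<epsilon> \<le> 1"
        "\<epsilon> \<le> unit_ball_vol (real DIM(real ^ 'd)) / 2 * r0 powr real DIM(real ^ 'd)"
      by (auto simp: \<epsilon>0_def)
    show "(\<exists>c::real. 0 < c \<and> (\<forall>f\<in>variable_Lorentz_space \<Omega> p q.
        weighted_rearrangement_norm \<Omega> p \<epsilon> \<kappa> v f \<le> ennreal c * variable_Lorentz_norm \<Omega> p q f))
      \<longleftrightarrow> bounded (\<kappa> ` {0<..\<epsilon>}) \<and> q \<le> v" (is "?E \<longleftrightarrow> ?B")
    proof
      assume ?E
      then obtain c where c: "0 < c" "\<And>f. f \<in> variable_Lorentz_space \<Omega> p q \<Longrightarrow>
          weighted_rearrangement_norm \<Omega> p \<epsilon> \<kappa> v f \<le> ennreal c * variable_Lorentz_norm \<Omega> p q f"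
        by blast
      show ?B
      proof (cases v)
        case top
        then show ?B
          using sup_embedding_imp_bounded[OF \<Omega> P P_def[symmetric] x0(3) q r0 \<epsilon>(1,3) _ c(1), of \<kappa>] c(2) \<kappa>
          by (auto simp: less_imp_le)
      next
        case (real V)
        then have "0 < V" using \<kappa> by (simp add: order_less_le)
        then show ?B
          using integral_embedding_imp[OF \<Omega> P P_def[symmetric] x0(3) q r0 \<epsilon>(1,3) _ _ _ c(1), of \<kappa> V] c(2) \<kappa> real
          by auto
      qed
    next
      assume ?B
      then show ?E
        by (intro weighted_rearrangement_norm_upper[OF \<Omega> assms(2) P \<epsilon>(1,2) q]) auto
    qed
  next
    fix \<epsilon> and \<kappa> :: "real \<Rightarrow> real"
    assume "0 < \<epsilon> \<and> \<epsilon> \<le> \<epsilon>0" and \<kappa>: "\<forall>t\<in>{0<..\<epsilon>}. 0 \<le> \<kappa> t"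
    then have \<epsilon>: "0 < \<epsilon>" "\<epsilon> \<le> 1"
        "\<epsilon> \<le> unit_ball_vol (real DIM(real ^ 'd)) / 2 * r0 powr real DIM(real ^ 'd)"
      by (auto simp: \<epsilon>0_def)
    show "(\<exists>c::real. 0 < c \<and> (\<forall>f\<in>variable_Lorentz_space \<Omega> p q.
        weighted_rearrangement_norm \<Omega> p \<epsilon> \<kappa> \<infinity> f \<le> ennreal c * variable_Lorentz_norm \<Omega> p q f))
      \<longleftrightarrow> bounded (\<kappa> ` {0<..\<epsilon>})" (is "?E \<longleftrightarrow> ?B")
    proof
      assume ?E
      then show ?B
        using sup_embedding_imp_bounded[OF \<Omega> P P_def[symmetric] x0(3) q r0 \<epsilon>(1,3), of \<kappa>] \<kappa> by blast
    next
      assume ?B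
      then show ?E
        by (intro weighted_rearrangement_norm_upper[OF \<Omega> assms(2) P \<epsilon>(1,2) q]) auto
    qed
  qed
qed

end
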